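(* Let $E$ be a Banach lattice. The following are equivalent: (1) $E$ is uniformly monotone. (2) $E^{(p)}$ is uniformly convex for all $1<p<\infty$. (3) $E^{(p)}$ is uniformly convex for some $1<p<\infty$.
   Context: For a Banach lattice $E$ and $1<p<\infty$, the $p$-convexification $E^{(p)}$ is the vector lattice with the same underlying set and order as $E$ but with new operations $x\oplus y=(x^{1/p}+y^{1/p})^p$ and $\alpha\odot x=\alpha^p x$ (where for real $t$, $t^{s}$ means $\mathrm{sign}(t)|t|^{s}$, defined via the Krivine functional calculus), normed by $\|x\|_{E^{(p)}}=\|x\|_E^{1/p}$; it is a Banach lattice. For $1\le q<\infty$ and $\epsilon>0$ put $M_q(\epsilon)=\inf\{\|(|x|^q+|y|^q)^{1/q}\|-1:\|y\|\ge\epsilon,\ \|x\|=1\}$. $E$ is uniformly monotone if for some $1\le q<\infty$, $M_q(\epsilon)>0$ for every $\epsilon>0$. A Banach space $X$ is uniformly convex if for every $\epsilon>0$ there is $\delta>0$ with $\inf\{\max\{\|x+y\|,\|x-y\|\}:\|y\|\ge\epsilon,\|x\|=1\}\ge1+\delta$. *)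

theory Defs
  imports "HOL-Analysis.Analysis"
begin

definition labs :: "'a::{ab_group_add, lattice} \<Rightarrow> 'a" where
  "labs x = sup x (- x)"

definition banach_lattice :: "'a::{banach, ordered_real_vector, lattice} itself \<Rightarrow> bool" where
  "banach_lattice _ \<longleftrightarrow> (\<forall>x y::'a. labs x \<le> labs y \<longrightarrow> norm x \<le> norm y)"

definition sgnpow :: "real \<Rightarrow> real \<Rightarrow> real" where
  "sgnpow t s = sgn t * (\<bar>t\<bar> powr s)"

definition H2 :: "(real \<times> real \<Rightarrow> real) set" where
  "H2 = {f. continuous_on UNIV f \<and> (\<forall>t\<ge>0. \<forall>v. f (t *\<^sub>R v) = t * f v)}"

definition krivine_hom :: "((real \<times> real \<Rightarrow> real) \<Rightarrow> 'a::{real_vector, lattice}) \<Rightarrow> bool" where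
  "krivine_hom T \<longleftrightarrow>
     (\<forall>f\<in>H2. \<forall>g\<in>H2. T (\<lambda>v. f v + g v) = T f + T g
                     \<and> T (\<lambda>v. max (f v) (g v)) = sup (T f) (T g)) \<and>
     (\<forall>f\<in>H2. \<forall>c. T (\<lambda>v. c * f v) = c *\<^sub>R T f)"

text \<open>Krivine functional calculus in two variables: f(x,y) is the image of f under the
  (unique) linear lattice homomorphism H_2 \<rightarrow> E sending the coordinate projections to x and y.\<close>
definition krivine :: "'a::{real_vector, lattice} \<Rightarrow> 'a \<Rightarrow> (real \<times> real \<Rightarrow> real) \<Rightarrow> 'a" where
  "krivine x y f = (THE z. \<exists>T. krivine_hom T \<and> T fst = x \<and> T snd = y \<and> T f = z)"

text \<open>The p-convexification E^(p): same set, new operations and norm.\<close>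
definition pconv_add :: "real \<Rightarrow> 'a::{real_vector, lattice} \<Rightarrow> 'a \<Rightarrow> 'a" where
  "pconv_add p x y = krivine x y (\<lambda>(s, t). sgnpow (sgnpow s (1 / p) + sgnpow t (1 / p)) p)"

definition pconv_smult :: "real \<Rightarrow> real \<Rightarrow> 'a::real_vector \<Rightarrow> 'a" where
  "pconv_smult p a x = sgnpow a p *\<^sub>R x"

definition pconv_norm :: "real \<Rightarrow> 'a::real_normed_vector \<Rightarrow> real" where
  "pconv_norm p x = norm x powr (1 / p)"

definition uniformly_convex_ops ::
  "('b \<Rightarrow> 'b \<Rightarrow> 'b) \<Rightarrow> (real \<Rightarrow> 'b \<Rightarrow> 'b) \<Rightarrow> ('b \<Rightarrow> real) \<Rightarrow> bool" where
  "uniformly_convex_ops add sm nrm \<longleftrightarrow>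
     (\<forall>\<epsilon>>0. \<exists>\<delta>>0. \<forall>x y. nrm x = 1 \<and> nrm y \<ge> \<epsilon> \<longrightarrow>
        max (nrm (add x y)) (nrm (add x (sm (-1) y))) \<ge> 1 + \<delta>)"

definition pconv_uniformly_convex :: "real \<Rightarrow> 'a::{real_normed_vector, lattice} itself \<Rightarrow> bool" where
  "pconv_uniformly_convex p _ \<longleftrightarrow>
     uniformly_convex_ops (pconv_add p :: 'a \<Rightarrow> 'a \<Rightarrow> 'a) (pconv_smult p) (pconv_norm p)"

text \<open>M_q(eps), as an extended real (infimum of the empty set is +infinity).\<close>
definition Mq :: "'a::{real_normed_vector, lattice} itself \<Rightarrow> real \<Rightarrow> real \<Rightarrow> ereal" where
  "Mq _ q \<epsilon> = Inf {ereal (norm (krivine x y (\<lambda>(s, t). (\<bar>s\<bar> powr q + \<bar>t\<bar> powr q) powr (1 / q))) - 1)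
                    | x y :: 'a. norm y \<ge> \<epsilon> \<and> norm x = 1}"

definition uniformly_monotone :: "'a::{real_normed_vector, lattice} itself \<Rightarrow> bool" where
  "uniformly_monotone E \<longleftrightarrow> (\<exists>q\<ge>1. \<forall>\<epsilon>>0. Mq E q \<epsilon> > 0)"

end

theory Submission
  imports Defs
begin

text \<open>The Krivine calculus is built on suprema of finitely many linear forms: by separation, an
  inequality between such suprema on the plane is an inclusion of convex hulls of coefficients, hence
  holds in every vector lattice. A lattice Stone--Weierstrass argument and completeness extend the
  calculus to all continuous homogeneous functions, and uniqueness gives the composition rule.

  Uniform monotonicity for any exponent \<open>q\<close> implies it for \<open>q = 1\<close>. If it holds, uniform convexity
  of \<open>E\<^sup>(\<^sup>p\<^sup>)\<close> follows from the quantitative strict convexity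
  \<open>(|s + t|\<^sup>p + |s - t|\<^sup>p) / 2 \<ge> |s|\<^sup>p + c (|t|\<^sup>p - \<kappa> |s|\<^sup>p)\<^sup>+\<close>. Conversely, if \<open>\<parallel>|x| + |y|\<parallel>\<close> is close to
  \<open>\<parallel>x\<parallel> = 1\<close>, then \<open>|x|\<close> and \<open>|x| + |y|\<close> are two points of \<open>E\<^sup>(\<^sup>p\<^sup>)\<close> whose norms, together with that of
  their midpoint, are all close to \<open>1\<close>; uniform convexity makes their difference small in
  \<open>E\<^sup>(\<^sup>p\<^sup>)\<close>, which forces \<open>y\<close> to be small in \<open>E\<close>.\<close>

section \<open>Vector lattices\<close>

lemma sup_add_distrib:
  fixes a b c :: "'a::{ordered_real_vector, lattice}"
  shows "sup a b + c = sup (a + c) (b + c)"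
proof (rule antisym)
  have "sup a b \<le> sup (a + c) (b + c) - c"
    by (rule sup_least) (simp_all add: le_diff_eq)
  then show "sup a b + c \<le> sup (a + c) (b + c)"
    by (simp only: le_diff_eq)
qed (simp add: add_right_mono)

lemma scaleR_sup_distrib:
  fixes a b :: "'a::{ordered_real_vector, lattice}"
  assumes "0 \<le> c"
  shows "c *\<^sub>R sup a b = sup (c *\<^sub>R a) (c *\<^sub>R b)"
proof (cases "c = 0")
  case False
  with assms have c: "0 < c" by simp
  show ?thesis
  proof (rule antisym)
    have "sup a b \<le> (1 / c) *\<^sub>R sup (c *\<^sub>R a) (c *\<^sub>R b)"
      using c by (simp add: pos_le_divideR_eq divide_inverse)
    then show "c *\<^sub>R sup a b \<le> sup (c *\<^sub>R a) (c *\<^sub>R b)"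
      using c scaleR_left_mono[of "sup a b" "(1 / c) *\<^sub>R sup (c *\<^sub>R a) (c *\<^sub>R b)" c] by simp
  qed (use c in \<open>simp add: scaleR_left_mono\<close>)
qed simp

text \<open>Adding \<open>a \<le> labs a\<close> and \<open>- a \<le> labs a\<close> gives
  \<open>0 \<le> labs a + labs a\<close>, and halving is available in a real ordered vector
  space.\<close>

lemma labs_nonneg: "0 \<le> labs (a::'a::{ordered_real_vector, lattice})"
proof -
  have "a + (- a) \<le> labs a + labs a"
    unfolding labs_def by (intro add_mono) auto
  then have "0 \<le> (1/2::real) *\<^sub>R (labs a + labs a)"
    by (intro scaleR_nonneg_nonneg) auto
  then show ?thesis
    by (simp flip: scaleR_2)
qed

lemma labs_of_nonneg: "0 \<le> a \<Longrightarrow> labs a = (a::'a::{ordered_real_vector, lattice})"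
  unfolding labs_def by (rule sup_absorb1) (meson neg_le_0_iff_le order_trans)

lemma labs_le_iff: "labs a \<le> b \<longleftrightarrow> a \<le> b \<and> - a \<le> (b::'a::{ordered_real_vector, lattice})"
  by (simp add: labs_def)

lemma le_labs: "a \<le> labs a" "- a \<le> labs (a::'a::{ordered_real_vector, lattice})"
  by (simp_all add: labs_def)

lemma labs_minus: "labs (- a) = labs (a::'a::{ordered_real_vector, lattice})"
  by (simp add: labs_def sup_commute)

text \<open>Both \<open>a\<close> and \<open>b\<close> lie below \<open>sup c d\<close> plus the two
  deviations; exchanging the pairs gives the other sign. This is what makes \<open>sup\<close>
  Lipschitz for a lattice norm.\<close>

lemma labs_sup_diff_le:
  fixes a b c d :: "'a::{ordered_real_vector, lattice}"
  shows "labs (sup a b - sup c d) \<le> labs (a - c) + labs (b - d)"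
proof -
  have *: "sup a b - sup c d \<le> labs (a - c) + labs (b - d)" for a b c d :: 'a
  proof -
    have "a \<le> sup c d + (labs (a - c) + labs (b - d))"
      using add_mono[OF sup_ge1[of c d] add_mono[OF le_labs(1)[of "a - c"] labs_nonneg[of "b - d"]]]
      by simp
    moreover have "b \<le> sup c d + (labs (a - c) + labs (b - d))"
      using add_mono[OF sup_ge2[of d c] add_mono[OF labs_nonneg[of "a - c"] le_labs(1)[of "b - d"]]]
      by simp
    ultimately show ?thesis
      by (simp add: diff_le_eq add.commute)
  qed
  show ?thesis
    using *[of a b c d] *[of c d a b] labs_minus[of "a - c"] labs_minus[of "b - d"]
    by (simp add: labs_le_iff)
qed

section \<open>Suprema of finitely many linear forms\<close>

definition lincomb :: "'a::real_vector \<Rightarrow> 'a \<Rightarrow> real \<times> real \<Rightarrow> 'a" where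
  "lincomb x y a = fst a *\<^sub>R x + snd a *\<^sub>R y"

lemma lincomb_add: "lincomb x y (a + b) = lincomb x y a + lincomb x y b"
  by (simp add: lincomb_def algebra_simps)

lemma lincomb_scaleR: "lincomb x y (c *\<^sub>R a) = c *\<^sub>R lincomb x y a"
  by (simp add: lincomb_def algebra_simps)

lemma lincomb_zero [simp]: "lincomb x y 0 = 0"
  by (simp add: lincomb_def)

lemma lincomb_real: "lincomb (fst v) (snd v) a = a \<bullet> (v::real \<times> real)"
  by (simp add: lincomb_def inner_prod_def)

text \<open>For real arguments \<open>fst v\<close>, \<open>snd v\<close> this is the support
  function of \<open>A\<close> at \<open>v\<close>. \<open>Sup_fin\<close> is meaningful only for
  finite nonempty sets, whence the recurring side conditions.\<close>

definition lin_sup :: "'a::{real_vector, lattice} \<Rightarrow> 'a \<Rightarrow> (real \<times> real) set \<Rightarrow> 'a" where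
  "lin_sup x y A = Sup_fin (lincomb x y ` A)"

context
  fixes x y :: "'a::{ordered_real_vector, lattice}"
begin

lemma lin_sup_le_iff:
  "finite A \<Longrightarrow> A \<noteq> {} \<Longrightarrow> lin_sup x y A \<le> z \<longleftrightarrow> (\<forall>a\<in>A. lincomb x y a \<le> z)"
  unfolding lin_sup_def by (subst Sup_fin.bounded_iff) auto

lemma lin_sup_ge: "finite A \<Longrightarrow> a \<in> A \<Longrightarrow> lincomb x y a \<le> lin_sup x y A"
  unfolding lin_sup_def by (intro Sup_fin.coboundedI) auto

lemma lin_sup_single [simp]: "lin_sup x y {a} = lincomb x y a"
  by (simp add: lin_sup_def)

lemma lin_sup_insert:
  "finite A \<Longrightarrow> A \<noteq> {} \<Longrightarrow> lin_sup x y (insert a A) = sup (lincomb x y a) (lin_sup x y A)"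
  by (simp add: lin_sup_def)

lemma lin_sup_Un:
  "finite A \<Longrightarrow> A \<noteq> {} \<Longrightarrow> finite B \<Longrightarrow> B \<noteq> {} \<Longrightarrow>
    lin_sup x y (A \<union> B) = sup (lin_sup x y A) (lin_sup x y B)"
  by (simp add: lin_sup_def image_Un Sup_fin.union)

text \<open>Suprema are taken one summand at a time: with \<open>b\<close> fixed, its form is moved
  to the other side and the supremum over \<open>A\<close> is formed, then likewise over
  \<open>B\<close>. The set on the left is the Minkowski sum.\<close>

lemma lin_sup_plus:
  assumes "finite A" "A \<noteq> {}" "finite B" "B \<noteq> {}"
  shows "lin_sup x y ((\<lambda>(a, b). a + b) ` (A \<times> B)) = lin_sup x y A + lin_sup x y B"
    (is "lin_sup x y ?C = _")
proof (rule antisym)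
  show "lin_sup x y ?C \<le> lin_sup x y A + lin_sup x y B"
    using assms by (subst lin_sup_le_iff) (auto simp: lincomb_add intro!: add_mono lin_sup_ge)
  have "lincomb x y a + lincomb x y b \<le> lin_sup x y ?C" if "a \<in> A" "b \<in> B" for a b
    using lin_sup_ge[of ?C "a + b"] that assms by (force simp: lincomb_add)
  then have "lin_sup x y A \<le> lin_sup x y ?C - lincomb x y b" if "b \<in> B" for b
    using assms that by (subst lin_sup_le_iff) (auto simp: le_diff_eq)
  then have "lin_sup x y B \<le> lin_sup x y ?C - lin_sup x y A"
    using assms by (subst lin_sup_le_iff) (auto simp: le_diff_eq add.commute)
  then show "lin_sup x y A + lin_sup x y B \<le> lin_sup x y ?C"
    by (simp add: le_diff_eq add.commute)
qed

lemma lin_sup_scaleR: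
  assumes "finite A" "A \<noteq> {}" "0 \<le> c"
  shows "lin_sup x y ((*\<^sub>R) c ` A) = c *\<^sub>R lin_sup x y A"
  using assms(1,2)
proof (induction A rule: finite_ne_induct)
  case (insert a A)
  then show ?case
    using assms(3) by (simp add: lin_sup_insert lincomb_scaleR scaleR_sup_distrib)
qed (simp add: lincomb_scaleR)

text \<open>By separation, an inequality between suprema of linear forms on the plane says that the
  coefficient vectors on the left are convex combinations of those on the right; this passes to
  every vector lattice.\<close>

lemma lin_sup_mono:
  assumes A: "finite A" "A \<noteq> {}" and B: "finite B" "B \<noteq> {}"
    and le: "\<And>v::real \<times> real. lin_sup (fst v) (snd v) A \<le> lin_sup (fst v) (snd v) B"
  shows "lin_sup x y A \<le> lin_sup x y B"
proof -
  have "a \<in> convex hull B" if "a \<in> A" for a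
  proof (rule ccontr)
    assume "a \<notin> convex hull B"
    moreover have "closed (convex hull B)"
      using B by (simp add: finite_imp_compact_convex_hull compact_imp_closed)
    ultimately obtain w b where w: "w \<bullet> a < b" "\<forall>z\<in>convex hull B. b < w \<bullet> z"
      using separating_hyperplane_closed_point[OF convex_convex_hull] by blast
    \<comment> \<open>Testing the hypothesis at \<open>- w\<close> reverses the separation: the form
      of \<open>a\<close> is above \<open>- b\<close> there, while all forms from \<open>B\<close>
      are below \<open>- b\<close>.\<close>
    have "lincomb (fst (- w)) (snd (- w)) a \<le> lin_sup (fst (- w)) (snd (- w)) B"
      using order_trans[OF _ le] A(1) that
      by (metis Sup_fin.coboundedI finite_imageI imageI lin_sup_def)
    moreover have "lin_sup (fst (- w)) (snd (- w)) B \<le> - b"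
      unfolding lin_sup_def using B w(2) hull_inc[of _ B convex]
      by (subst Sup_fin.bounded_iff) (auto simp: lincomb_real inner_commute less_imp_le simp del: fst_uminus snd_uminus)
    ultimately show False
      using w(1) by (simp add: lincomb_real inner_commute del: fst_uminus snd_uminus)
  qed
  \<comment> \<open>The coefficient vectors whose form stays below a fixed element form a convex
    set, so containing \<open>B\<close> it contains the hull.\<close>
  moreover have "convex hull B \<subseteq> {a. lincomb x y a \<le> lin_sup x y B}"
  proof (rule hull_minimal)
    show "convex {a. lincomb x y a \<le> lin_sup x y B}"
    proof (rule convexI, safe)
      fix a b :: "real \<times> real" and u v :: real
      assume *: "lincomb x y a \<le> lin_sup x y B" "lincomb x y b \<le> lin_sup x y B"
        "0 \<le> u" "0 \<le> v" "u + v = 1"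
      have "u *\<^sub>R lincomb x y a + v *\<^sub>R lincomb x y b \<le> u *\<^sub>R lin_sup x y B + v *\<^sub>R lin_sup x y B"
        using * by (intro add_mono scaleR_left_mono)
      then show "lincomb x y (u *\<^sub>R a + v *\<^sub>R b) \<le> lin_sup x y B"
        using * by (simp add: lincomb_add lincomb_scaleR flip: scaleR_add_left)
    qed
  qed (use B lin_sup_ge in auto)
  ultimately show ?thesis
    using A by (subst lin_sup_le_iff) auto
qed

end

section \<open>Piecewise linear functions\<close>

text \<open>The homogeneous piecewise linear functions are the differences of suprema of linear forms;
  \<open>pwl x y f z\<close> says that \<open>z\<close> is the value of such an \<open>f\<close> at \<open>(x, y)\<close>.\<close>

definition pwl :: "'a::{ordered_real_vector, lattice} \<Rightarrow> 'a \<Rightarrow> (real \<times> real \<Rightarrow> real) \<Rightarrow> 'a \<Rightarrow> bool" where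
  "pwl x y f z \<longleftrightarrow> (\<exists>A B. finite A \<and> A \<noteq> {} \<and> finite B \<and> B \<noteq> {} \<and>
     f = (\<lambda>v. lin_sup (fst v) (snd v) A - lin_sup (fst v) (snd v) B) \<and>
     z = lin_sup x y A - lin_sup x y B)"

lemma pwlE:
  assumes "pwl x y f z"
  obtains A B where "finite A" "A \<noteq> {}" "finite B" "B \<noteq> {}"
    "f = (\<lambda>v. lin_sup (fst v) (snd v) A - lin_sup (fst v) (snd v) B)"
    "z = lin_sup x y A - lin_sup x y B"
  using assms unfolding pwl_def by blast

lemma pwlI:
  assumes "finite A" "A \<noteq> {}" "finite B" "B \<noteq> {}"
    "\<And>v. f v = lin_sup (fst v) (snd v) A - lin_sup (fst v) (snd v) B"
    "z = lin_sup x y A - lin_sup x y B"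
  shows "pwl x y f z"
  using assms unfolding pwl_def by blast

lemma pwl_lincomb: "pwl x y (\<lambda>v. a \<bullet> v) (lincomb x y a)"
  by (rule pwlI[of "{a}" "{0}"]) (simp_all add: lincomb_real)

lemma pwl_add:
  assumes "pwl x y f z" "pwl x y g w"
  shows "pwl x y (\<lambda>v. f v + g v) (z + w)"
proof -
  obtain A B where AB: "finite A" "A \<noteq> {}" "finite B" "B \<noteq> {}"
    "f = (\<lambda>v. lin_sup (fst v) (snd v) A - lin_sup (fst v) (snd v) B)"
    "z = lin_sup x y A - lin_sup x y B"
    using assms(1) by (rule pwlE)
  obtain C D where CD: "finite C" "C \<noteq> {}" "finite D" "D \<noteq> {}"
    "g = (\<lambda>v. lin_sup (fst v) (snd v) C - lin_sup (fst v) (snd v) D)"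
    "w = lin_sup x y C - lin_sup x y D"
    using assms(2) by (rule pwlE)
  show ?thesis
    by (rule pwlI[of "(\<lambda>(a, b). a + b) ` (A \<times> C)" "(\<lambda>(a, b). a + b) ` (B \<times> D)"])
      (use AB CD in \<open>simp_all add: lin_sup_plus\<close>)
qed

lemma pwl_uminus: "pwl x y f z \<Longrightarrow> pwl x y (\<lambda>v. - f v) (- z)"
  by (erule pwlE, rule pwlI) auto

lemma pwl_scale:
  assumes "pwl x y f z"
  shows "pwl x y (\<lambda>v. c * f v) (c *\<^sub>R z)"
proof -
  have *: "pwl x y (\<lambda>v. c * f v) (c *\<^sub>R z)" if "0 \<le> c" for c
    using assms
  proof (rule pwlE)
    fix A B assume AB: "finite A" "A \<noteq> {}" "finite B" "B \<noteq> {}"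
      "f = (\<lambda>v. lin_sup (fst v) (snd v) A - lin_sup (fst v) (snd v) B)"
      "z = lin_sup x y A - lin_sup x y B"
    show ?thesis
      by (rule pwlI[of "(*\<^sub>R) c ` A" "(*\<^sub>R) c ` B"])
        (use AB that in \<open>simp_all add: lin_sup_scaleR right_diff_distrib scaleR_diff_right\<close>)
  qed
  show ?thesis
    using *[of c] pwl_uminus[OF *[of "- c"]] by (cases "0 \<le> c") auto
qed

text \<open>Differences are brought to a common subtrahend,
  \<open>sup (a - b) (c - d) = sup (a + d) (c + b) - (b + d)\<close>, after which unions and
  Minkowski sums of coefficient sets represent the result.\<close>

lemma pwl_max:
  assumes "pwl x y f z" "pwl x y g w"
  shows "pwl x y (\<lambda>v. max (f v) (g v)) (sup z w)"
proof -
  obtain A B where AB: "finite A" "A \<noteq> {}" "finite B" "B \<noteq> {}"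
    "f = (\<lambda>v. lin_sup (fst v) (snd v) A - lin_sup (fst v) (snd v) B)"
    "z = lin_sup x y A - lin_sup x y B"
    using assms(1) by (rule pwlE)
  obtain C D where CD: "finite C" "C \<noteq> {}" "finite D" "D \<noteq> {}"
    "g = (\<lambda>v. lin_sup (fst v) (snd v) C - lin_sup (fst v) (snd v) D)"
    "w = lin_sup x y C - lin_sup x y D"
    using assms(2) by (rule pwlE)
  have sup_diff: "sup (a - b) (c - d) = sup (a + d) (c + b) - (b + d)"
    for a b c d :: "'c::{ordered_real_vector, lattice}"
    using sup_add_distrib[of "a + d" "c + b" "- (b + d)"] by (simp add: algebra_simps)
  show ?thesis
    by (rule pwlI[of "(\<lambda>(a, b). a + b) ` (A \<times> D) \<union> (\<lambda>(a, b). a + b) ` (C \<times> B)"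
            "(\<lambda>(a, b). a + b) ` (B \<times> D)"])
      (use AB CD in \<open>simp_all add: lin_sup_plus lin_sup_Un sup_diff flip: sup_max\<close>)
qed

text \<open>Moving the subtracted terms across leaves an inequality between two suprema of linear
  forms, to which \<open>lin_sup_mono\<close> applies. In particular the value depends on the
  function only, not on the chosen representation.\<close>

lemma pwl_mono:
  assumes "pwl x y f z" "pwl x y g w" "\<And>v. f v \<le> g v"
  shows "z \<le> w"
proof -
  obtain A B where AB: "finite A" "A \<noteq> {}" "finite B" "B \<noteq> {}"
    "f = (\<lambda>v. lin_sup (fst v) (snd v) A - lin_sup (fst v) (snd v) B)"
    "z = lin_sup x y A - lin_sup x y B"
    using assms(1) by (rule pwlE)
  obtain C D where CD: "finite C" "C \<noteq> {}" "finite D" "D \<noteq> {}"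
    "g = (\<lambda>v. lin_sup (fst v) (snd v) C - lin_sup (fst v) (snd v) D)"
    "w = lin_sup x y C - lin_sup x y D"
    using assms(2) by (rule pwlE)
  have "lin_sup x y ((\<lambda>(a, b). a + b) ` (A \<times> D)) \<le> lin_sup x y ((\<lambda>(a, b). a + b) ` (C \<times> B))"
  proof (rule lin_sup_mono)
    fix v :: "real \<times> real"
    show "lin_sup (fst v) (snd v) ((\<lambda>(a, b). a + b) ` (A \<times> D))
       \<le> lin_sup (fst v) (snd v) ((\<lambda>(a, b). a + b) ` (C \<times> B))"
      using assms(3)[of v] AB CD by (simp add: lin_sup_plus)
  qed (use AB CD in auto)
  then have "lin_sup x y A + lin_sup x y D \<le> lin_sup x y C + lin_sup x y B"
    using AB CD by (simp add: lin_sup_plus)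
  then show ?thesis
    unfolding AB(6) CD(6) by (simp only: diff_le_eq diff_add_eq le_diff_eq)
qed

section \<open>Lattice Stone--Weierstrass approximation\<close>

text \<open>A continuous \<open>g\<close> exceeding \<open>h\<close> at a point does so on a
  neighbourhood; finitely many such neighbourhoods cover \<open>K\<close>, and the maximum of the
  corresponding functions works everywhere.\<close>

lemma compact_max_above:
  fixes h :: "'b::topological_space \<Rightarrow> real"
  assumes K: "compact K" "K \<noteq> {}" and h: "continuous_on UNIV h"
    and cont: "\<And>g. g \<in> L \<Longrightarrow> continuous_on UNIV g"
    and max: "\<And>f g. f \<in> L \<Longrightarrow> g \<in> L \<Longrightarrow> (\<lambda>v. max (f v) (g v)) \<in> L"
    and ex: "\<And>q. q \<in> K \<Longrightarrow> \<exists>g\<in>L. h q < g q"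
  shows "\<exists>g\<in>L. \<forall>q\<in>K. h q < g q"
proof -
  have "open {v. h v < g v}" if "g \<in> L" for g
    using h cont[OF that] by (rule open_Collect_less)
  moreover have "K \<subseteq> (\<Union>g\<in>L. {v. h v < g v})"
    using ex by blast
  ultimately obtain D where D: "D \<subseteq> L" "finite D" "K \<subseteq> (\<Union>g\<in>D. {v. h v < g v})"
    by (rule compactE_image[OF K(1)])
  have "\<exists>g\<in>L. \<forall>f\<in>D. \<forall>v. f v \<le> g v" if "D \<noteq> {}"
    using D(2) that D(1)
  proof (induction D rule: finite_ne_induct)
    case (insert f D)
    then obtain g where "g \<in> L" "\<forall>f\<in>D. \<forall>v. f v \<le> g v" by auto
    then show ?case
      using insert max[of f g] by (intro bexI[of _ "\<lambda>v. max (f v) (g v)"]) (auto simp: le_max_iff_disj)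
  qed auto
  moreover have "D \<noteq> {}"
    using D(3) K(2) by auto
  ultimately obtain g where "g \<in> L" "\<forall>f\<in>D. \<forall>v. f v \<le> g v" by blast
  then show ?thesis
    using D(3) by (intro bexI[of _ g]) (force intro: less_le_trans)+
qed

text \<open>Two compactness passes. For fixed \<open>p\<close>, maxima of interpolants stay above
  \<open>f - \<epsilon>\<close> on \<open>K\<close> while remaining below
  \<open>f + \<epsilon>\<close> at \<open>p\<close>; minima of these functions over finitely many
  \<open>p\<close> are then below \<open>f + \<epsilon>\<close> on \<open>K\<close> too.\<close>

lemma lattice_Stone_Weierstrass:
  fixes f :: "'b::topological_space \<Rightarrow> real"
  assumes K: "compact K" "K \<noteq> {}" and f: "continuous_on UNIV f" and "0 < \<epsilon>"
    and cont: "\<And>g. g \<in> L \<Longrightarrow> continuous_on UNIV g"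
    and max: "\<And>f g. f \<in> L \<Longrightarrow> g \<in> L \<Longrightarrow> (\<lambda>v. max (f v) (g v)) \<in> L"
    and min: "\<And>f g. f \<in> L \<Longrightarrow> g \<in> L \<Longrightarrow> (\<lambda>v. min (f v) (g v)) \<in> L"
    and interp: "\<And>p q. p \<in> K \<Longrightarrow> q \<in> K \<Longrightarrow> \<exists>g\<in>L. g p = f p \<and> g q = f q"
  shows "\<exists>g\<in>L. \<forall>v\<in>K. \<bar>f v - g v\<bar> < \<epsilon>"
proof -
  have above: "\<exists>g\<in>{g\<in>L. g p < f p + \<epsilon>}. \<forall>q\<in>K. f q - \<epsilon> < g q" if "p \<in> K" for p
  proof (rule compact_max_above[OF K])
    fix q assume "q \<in> K"
    then show "\<exists>g\<in>{g\<in>L. g p < f p + \<epsilon>}. f q - \<epsilon> < g q"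
      using interp[OF that, of q] \<open>0 < \<epsilon>\<close> by fastforce
  qed (use cont max f in \<open>auto intro!: continuous_intros\<close>)
  \<comment> \<open>Negation turns the second pass, which needs minima, into another instance of
    \<open>compact_max_above\<close>.\<close>
  let ?L = "{\<lambda>v. - g v | g. g \<in> L \<and> (\<forall>q\<in>K. f q - \<epsilon> < g q)}"
  have "\<exists>g\<in>?L. \<forall>p\<in>K. - f p - \<epsilon> < g p"
  proof (rule compact_max_above[OF K])
    fix g h assume "g \<in> ?L" "h \<in> ?L"
    then obtain g' h' where *: "g = (\<lambda>v. - g' v)" "h = (\<lambda>v. - h' v)" "g' \<in> L" "h' \<in> L"
      "\<forall>q\<in>K. f q - \<epsilon> < g' q" "\<forall>q\<in>K. f q - \<epsilon> < h' q" by auto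
    have "(\<lambda>v. max (g v) (h v)) = (\<lambda>v. - min (g' v) (h' v))"
      using * by (auto simp: max_def min_def)
    then show "(\<lambda>v. max (g v) (h v)) \<in> ?L"
      using * min[of g' h'] by (auto intro!: exI[of _ "\<lambda>v. min (g' v) (h' v)"])
  next
    fix p assume "p \<in> K"
    then obtain g where "g \<in> L" "g p < f p + \<epsilon>" "\<forall>q\<in>K. f q - \<epsilon> < g q"
      using above by blast
    then show "\<exists>g\<in>?L. - f p - \<epsilon> < g p"
      by (intro bexI[of _ "\<lambda>v. - g v"]) auto
  qed (use cont f in \<open>auto intro!: continuous_intros\<close>)
  then obtain g where "g \<in> L" "\<forall>q\<in>K. f q - \<epsilon> < g q" "\<forall>p\<in>K. - f p - \<epsilon> < - g p"
    by blast
  then show ?thesis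
    by (intro bexI[of _ g]) (fastforce simp: abs_less_iff)+
qed

section \<open>Continuous homogeneous functions\<close>

lemma H2I:
  "continuous_on UNIV f \<Longrightarrow> (\<And>t v. 0 \<le> t \<Longrightarrow> f (t *\<^sub>R v) = t * f v) \<Longrightarrow> f \<in> H2"
  unfolding H2_def by blast

lemma H2_continuous: "f \<in> H2 \<Longrightarrow> continuous_on UNIV f"
  by (simp add: H2_def)

lemma H2_scaleR: "f \<in> H2 \<Longrightarrow> 0 \<le> t \<Longrightarrow> f (t *\<^sub>R v) = t * f v"
  unfolding H2_def by blast

lemma H2_fst: "fst \<in> H2" and H2_snd: "snd \<in> H2"
  by (auto intro!: H2I continuous_intros)

lemma H2_add: "f \<in> H2 \<Longrightarrow> g \<in> H2 \<Longrightarrow> (\<lambda>v. f v + g v) \<in> H2"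
  by (auto simp: H2_def algebra_simps intro!: continuous_intros)

lemma H2_diff: "f \<in> H2 \<Longrightarrow> g \<in> H2 \<Longrightarrow> (\<lambda>v. f v - g v) \<in> H2"
  by (auto simp: H2_def algebra_simps intro!: continuous_intros)

lemma H2_cmult: "f \<in> H2 \<Longrightarrow> (\<lambda>v. c * f v) \<in> H2"
  by (auto simp: H2_def algebra_simps intro!: continuous_intros)

lemma H2_uminus: "f \<in> H2 \<Longrightarrow> (\<lambda>v. - f v) \<in> H2"
  by (auto simp: H2_def intro!: continuous_intros)

lemma H2_max: "f \<in> H2 \<Longrightarrow> g \<in> H2 \<Longrightarrow> (\<lambda>v. max (f v) (g v)) \<in> H2"
  by (auto simp: H2_def max_mult_distrib_left intro!: continuous_intros)

lemma H2_abs: "f \<in> H2 \<Longrightarrow> (\<lambda>v. \<bar>f v\<bar>) \<in> H2"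
  by (auto simp: H2_def abs_mult intro!: continuous_intros)

lemma H2_inner: "(\<lambda>v. a \<bullet> v) \<in> H2"
  by (rule H2I) (auto intro!: continuous_intros simp del: scaleR_prod_def)

lemma H2_compose:
  assumes "f \<in> H2" "g \<in> H2" "h \<in> H2"
  shows "(\<lambda>v. h (f v, g v)) \<in> H2"
proof (rule H2I)
  show "continuous_on UNIV (\<lambda>v. h (f v, g v))"
    using assms by (intro continuous_on_compose2[OF H2_continuous[OF assms(3)]])
      (auto intro!: continuous_intros H2_continuous)
  show "h (f (t *\<^sub>R v), g (t *\<^sub>R v)) = t * h (f v, g v)" if "0 \<le> t" for t v
    using assms that H2_scaleR[OF assms(3) that, of "(f v, g v)"] by (simp add: H2_scaleR)
qed

lemmas H2_intros = H2_fst H2_snd H2_add H2_diff H2_cmult H2_uminus H2_max H2_abs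

text \<open>Linear forms cannot separate the values at antipodal points, but their positive parts
  can: for distinct unit vectors, \<open>(p - q) \<bullet> v\<close> is positive at \<open>p\<close>
  and negative at \<open>q\<close>, so its positive part vanishes at \<open>q\<close>.\<close>

lemma pwl_interpolation:
  fixes x y :: "'a::{ordered_real_vector, lattice}"
  assumes "norm p = 1" "norm q = 1" and "p = q \<Longrightarrow> \<alpha> = \<beta>"
  shows "\<exists>g w. pwl x y g w \<and> g p = \<alpha> \<and> g q = \<beta>"
proof -
  have pos: "\<exists>w. pwl x y (\<lambda>v. c * max (a \<bullet> v) 0) w" for a c
    using pwl_scale[OF pwl_max[OF pwl_lincomb[of x y a] pwl_lincomb[of x y 0]], of c] by auto
  show ?thesis
  proof (cases "p = q")
    case True
    obtain w where "pwl x y (\<lambda>v. \<alpha> * max (p \<bullet> v) 0) w"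
      using pos by blast
    moreover have "p \<bullet> p = 1"
      using assms(1) by (simp add: dot_square_norm)
    ultimately show ?thesis
      using True assms(3) by (intro exI[of _ "\<lambda>v. \<alpha> * max (p \<bullet> v) 0"] exI[of _ w]) auto
  next
    case False
    \<comment> \<open>As \<open>p\<close> and \<open>q\<close> are unit vectors, both forms take
      exactly the values \<open>d\<close> and \<open>- d\<close> at the two points, so dividing by
      \<open>d\<close> normalises them.\<close>
    define d where "d = 1 - p \<bullet> q"
    have pq: "p \<bullet> p = 1" "q \<bullet> q = 1"
      using assms(1,2) by (simp_all add: dot_square_norm)
    have "0 < (p - q) \<bullet> (p - q)"
      using False by simp
    then have d: "0 < d"
      using pq by (simp add: d_def inner_diff_left inner_diff_right inner_commute)
    obtain w1 where w1: "pwl x y (\<lambda>v. (\<alpha> / d) * max ((p - q) \<bullet> v) 0) w1"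
      using pos by blast
    obtain w2 where w2: "pwl x y (\<lambda>v. (\<beta> / d) * max ((q - p) \<bullet> v) 0) w2"
      using pos by blast
    have "(p - q) \<bullet> p = d" "(p - q) \<bullet> q = - d" "(q - p) \<bullet> p = - d" "(q - p) \<bullet> q = d"
      using pq by (simp_all add: d_def inner_diff_left inner_diff_right inner_commute)
    then show ?thesis
      using d by - (intro exI conjI, rule pwl_add[OF w1 w2], simp_all)
  qed
qed

lemma norm_prod_le_abs_add: "norm v \<le> \<bar>fst v\<bar> + \<bar>snd (v::real \<times> real)\<bar>"
  by (simp add: norm_prod_def sqrt_sum_squares_le_sum_abs)

lemma pwl_in_H2:
  assumes "pwl x y f z" shows "f \<in> H2"
proof -
  have *: "(\<lambda>v::real \<times> real. lin_sup (fst v) (snd v) A) \<in> H2" if "finite A" "A \<noteq> {}" for A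
    using that
  proof (induction A rule: finite_ne_induct)
    case (insert a A)
    then show ?case
      by (simp add: lin_sup_insert sup_max lincomb_real H2_max H2_inner)
  qed (simp add: lincomb_real H2_inner)
  show ?thesis
    using assms by (rule pwlE) (auto intro!: H2_diff *)
qed

text \<open>Uniform approximation on the unit circle extends to the plane by homogeneity. The error
  is weighted by \<open>\<bar>fst v\<bar> + \<bar>snd v\<bar>\<close> rather than the Euclidean norm
  because this weight is itself piecewise linear, with value \<open>labs x + labs y\<close>.\<close>

lemma pwl_dense:
  fixes x y :: "'a::{ordered_real_vector, lattice}"
  assumes f: "f \<in> H2" and "0 < \<epsilon>"
  shows "\<exists>g w. pwl x y g w \<and> (\<forall>v. \<bar>f v - g v\<bar> \<le> \<epsilon> * (\<bar>fst v\<bar> + \<bar>snd v\<bar>))"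
proof -
  let ?L = "{g. \<exists>w. pwl x y g w}" and ?K = "sphere 0 1 :: (real \<times> real) set"
  have min: "(\<lambda>v. min (f v) (g v)) \<in> ?L" if "f \<in> ?L" "g \<in> ?L" for f g
  proof -
    have "(\<lambda>v. min (f v) (g v)) = (\<lambda>v. - max (- f v) (- g v))"
      by (auto simp: min_def max_def)
    moreover obtain a b where "pwl x y f a" "pwl x y g b"
      using \<open>f \<in> ?L\<close> \<open>g \<in> ?L\<close> by auto
    ultimately show ?thesis
      using pwl_uminus[OF pwl_max[OF pwl_uminus pwl_uminus]] by fastforce
  qed
  have "(1, 0) \<in> ?K" by simp
  then have ne: "?K \<noteq> {}" by blast
  have "\<exists>g\<in>?L. \<forall>v\<in>?K. \<bar>f v - g v\<bar> < \<epsilon>"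
  proof (rule lattice_Stone_Weierstrass)
    show "\<exists>g\<in>?L. g p = f p \<and> g q = f q" if "p \<in> ?K" "q \<in> ?K" for p q
      using pwl_interpolation[of p q "f p" "f q" x y] that by auto
    show "(\<lambda>v. max (f v) (g v)) \<in> ?L" if "f \<in> ?L" "g \<in> ?L" for f g
      using that pwl_max by blast
    show "continuous_on UNIV g" if "g \<in> ?L" for g
      using that pwl_in_H2 H2_continuous by blast
  qed (use H2_continuous[OF f] \<open>0 < \<epsilon>\<close> ne min in \<open>assumption | simp\<close>)+
  then obtain g w where g: "pwl x y g w" "\<forall>v\<in>?K. \<bar>f v - g v\<bar> < \<epsilon>" by blast
  have d: "(\<lambda>v. f v - g v) \<in> H2"
    using f pwl_in_H2[OF g(1)] by (rule H2_diff)
  have "\<bar>f v - g v\<bar> \<le> \<epsilon> * (\<bar>fst v\<bar> + \<bar>snd v\<bar>)" for v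
  proof (cases "v = 0")
    case True
    then show ?thesis
      using H2_scaleR[OF d, of 0 0] by simp
  next
    case False
    define u where "u = (1 / norm v) *\<^sub>R v"
    have u: "norm v *\<^sub>R u = v" "u \<in> ?K"
      using False by (simp_all add: u_def)
    have "\<bar>f v - g v\<bar> = norm v * \<bar>f u - g u\<bar>"
      using H2_scaleR[OF d norm_ge_zero, of v u] by (simp only: u(1) abs_mult abs_norm_cancel)
    also have "\<dots> \<le> (\<bar>fst v\<bar> + \<bar>snd v\<bar>) * \<epsilon>"
      using g(2) u(2) by (intro mult_mono norm_prod_le_abs_add) (auto intro: less_imp_le)
    finally show ?thesis by (simp add: mult.commute)
  qed
  then show ?thesis
    using g(1) by blast
qed

section \<open>The Krivine functional calculus\<close>

lemma krivine_hom_add: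
  "krivine_hom T \<Longrightarrow> f \<in> H2 \<Longrightarrow> g \<in> H2 \<Longrightarrow> T (\<lambda>v. f v + g v) = T f + T g"
  by (simp add: krivine_hom_def)

lemma krivine_hom_max:
  "krivine_hom T \<Longrightarrow> f \<in> H2 \<Longrightarrow> g \<in> H2 \<Longrightarrow> T (\<lambda>v. max (f v) (g v)) = sup (T f) (T g)"
  by (simp add: krivine_hom_def)

lemma krivine_hom_cmult:
  "krivine_hom T \<Longrightarrow> f \<in> H2 \<Longrightarrow> T (\<lambda>v. c * f v) = c *\<^sub>R T f"
  by (simp add: krivine_hom_def)

lemma krivine_hom_uminus:
  "krivine_hom T \<Longrightarrow> f \<in> H2 \<Longrightarrow> T (\<lambda>v. - f v) = - T f"
  using krivine_hom_cmult[of T f "-1"] by simp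

lemma krivine_hom_diff:
  "krivine_hom T \<Longrightarrow> f \<in> H2 \<Longrightarrow> g \<in> H2 \<Longrightarrow> T (\<lambda>v. f v - g v) = T f - T g"
  using krivine_hom_add[of T f "\<lambda>v. - g v"] by (simp add: krivine_hom_uminus H2_uminus)

lemma krivine_hom_abs:
  assumes "krivine_hom T" "f \<in> H2"
  shows "T (\<lambda>v. \<bar>f v\<bar>) = labs (T f)"
proof -
  have "(\<lambda>v. \<bar>f v\<bar>) = (\<lambda>v. max (f v) (- f v))"
    by (auto simp: max_def)
  then show ?thesis
    using assms by (simp add: krivine_hom_max[OF assms(1)] krivine_hom_uminus[OF assms(1)] H2_uminus labs_def)
qed

lemma krivine_hom_mono:
  assumes "krivine_hom T" "f \<in> H2" "g \<in> H2" "\<And>v. f v \<le> g v"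
  shows "T f \<le> T g"
proof -
  have "(\<lambda>v. max (f v) (g v)) = g"
    using assms(4) by (auto simp: max_def)
  then show ?thesis
    using krivine_hom_max[OF assms(1-3)] by (simp add: le_iff_sup)
qed

text \<open>Piecewise linear functions are built from the coordinates by operations that a
  homomorphism preserves. Together with density this will force uniqueness.\<close>

lemma krivine_hom_pwl:
  fixes T :: "_ \<Rightarrow> 'a::{ordered_real_vector, lattice}"
  assumes T: "krivine_hom T" and "pwl (T fst) (T snd) f z"
  shows "T f = z"
proof -
  have inner: "T (\<lambda>v. a \<bullet> v) = lincomb (T fst) (T snd) a" for a
  proof -
    have "(\<lambda>v. a \<bullet> v) = (\<lambda>v. fst a * fst v + snd a * snd v)"
      by (auto simp: inner_prod_def)
    then show ?thesis
      by (simp add: krivine_hom_add[OF T] krivine_hom_cmult[OF T] lincomb_def H2_intros)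
  qed
  have *: "(\<lambda>v::real \<times> real. lin_sup (fst v) (snd v) A) \<in> H2 \<and>
      T (\<lambda>v. lin_sup (fst v) (snd v) A) = lin_sup (T fst) (T snd) A"
    if "finite A" "A \<noteq> {}" for A
    using that
  proof (induction A rule: finite_ne_induct)
    case (insert a A)
    then show ?case
      by (simp add: lin_sup_insert sup_max lincomb_real H2_max H2_inner krivine_hom_max[OF T] inner)
  qed (simp add: lincomb_real H2_inner inner)
  show ?thesis
    using assms(2) by (rule pwlE) (use * in \<open>auto simp: krivine_hom_diff[OF T]\<close>)
qed

text \<open>A limit formulated as a relation, so that the algebraic rules can be proved before
  existence and uniqueness. One \<open>\<epsilon>\<close> controls both the error of the function
  and the error of its value.\<close>

definition krivine_val ::
  "'a::{real_normed_vector, ordered_real_vector, lattice} \<Rightarrow> 'a \<Rightarrow> (real \<times> real \<Rightarrow> real) \<Rightarrow> 'a \<Rightarrow> bool" where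
  "krivine_val x y f z \<longleftrightarrow> (\<forall>\<epsilon>>0. \<exists>g w. pwl x y g w \<and>
     (\<forall>v. \<bar>f v - g v\<bar> \<le> \<epsilon> * (\<bar>fst v\<bar> + \<bar>snd v\<bar>)) \<and> norm (z - w) \<le> \<epsilon>)"

text \<open>The constant \<open>M\<close> absorbs the factors by which errors grow under the
  operations.\<close>

lemma krivine_valI:
  assumes "0 < M" "\<And>\<epsilon>. 0 < \<epsilon> \<Longrightarrow> \<exists>g w. pwl x y g w \<and>
     (\<forall>v. \<bar>f v - g v\<bar> \<le> (M * \<epsilon>) * (\<bar>fst v\<bar> + \<bar>snd v\<bar>)) \<and> norm (z - w) \<le> M * \<epsilon>"
  shows "krivine_val x y f z"
  unfolding krivine_val_def
proof safe
  fix \<epsilon> :: real assume "0 < \<epsilon>"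
  then show "\<exists>g w. pwl x y g w \<and> (\<forall>v. \<bar>f v - g v\<bar> \<le> \<epsilon> * (\<bar>fst v\<bar> + \<bar>snd v\<bar>)) \<and> norm (z - w) \<le> \<epsilon>"
    using assms(2)[of "\<epsilon> / M"] \<open>0 < M\<close> by simp
qed

lemma krivine_valE:
  assumes "krivine_val x y f z" "0 < \<epsilon>"
  obtains g w where "pwl x y g w" "\<And>v. \<bar>f v - g v\<bar> \<le> \<epsilon> * (\<bar>fst v\<bar> + \<bar>snd v\<bar>)" "norm (z - w) \<le> \<epsilon>"
  using assms unfolding krivine_val_def by blast

lemma krivine_val_pwl: "pwl x y f z \<Longrightarrow> krivine_val x y f z"
  unfolding krivine_val_def by (intro allI impI exI[of _ f] exI[of _ z]) auto

lemma krivine_val_add: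
  assumes "krivine_val x y f z" "krivine_val x y g w"
  shows "krivine_val x y (\<lambda>v. f v + g v) (z + w)"
proof (rule krivine_valI[of 2])
  fix \<epsilon> :: real assume "0 < \<epsilon>"
  obtain f' z' where 1: "pwl x y f' z'"
    "\<And>v. \<bar>f v - f' v\<bar> \<le> \<epsilon> * (\<bar>fst v\<bar> + \<bar>snd v\<bar>)" "norm (z - z') \<le> \<epsilon>"
    using krivine_valE[OF assms(1) \<open>0 < \<epsilon>\<close>] by blast
  obtain g' w' where 2: "pwl x y g' w'"
    "\<And>v. \<bar>g v - g' v\<bar> \<le> \<epsilon> * (\<bar>fst v\<bar> + \<bar>snd v\<bar>)" "norm (w - w') \<le> \<epsilon>"
    using krivine_valE[OF assms(2) \<open>0 < \<epsilon>\<close>] by blast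
  have "\<bar>f v + g v - (f' v + g' v)\<bar> \<le> (2 * \<epsilon>) * (\<bar>fst v\<bar> + \<bar>snd v\<bar>)" for v
    using 1(2)[of v] 2(2)[of v] by linarith
  moreover have "norm (z + w - (z' + w')) \<le> 2 * \<epsilon>"
    using norm_diff_triangle_ineq[of z w z' w'] 1(3) 2(3) by linarith
  ultimately show "\<exists>h u. pwl x y h u \<and>
      (\<forall>v. \<bar>f v + g v - h v\<bar> \<le> (2 * \<epsilon>) * (\<bar>fst v\<bar> + \<bar>snd v\<bar>)) \<and> norm (z + w - u) \<le> 2 * \<epsilon>"
    using pwl_add[OF 1(1) 2(1)] by blast
qed simp

lemma krivine_val_cmult:
  assumes "krivine_val x y f z"
  shows "krivine_val x y (\<lambda>v. c * f v) (c *\<^sub>R z)"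
proof (rule krivine_valI[of "\<bar>c\<bar> + 1"])
  fix \<epsilon> :: real assume "0 < \<epsilon>"
  obtain f' z' where 1: "pwl x y f' z'"
    "\<And>v. \<bar>f v - f' v\<bar> \<le> \<epsilon> * (\<bar>fst v\<bar> + \<bar>snd v\<bar>)" "norm (z - z') \<le> \<epsilon>"
    using krivine_valE[OF assms(1) \<open>0 < \<epsilon>\<close>] by blast
  have "\<bar>c * f v - c * f' v\<bar> \<le> (\<bar>c\<bar> + 1) * \<epsilon> * (\<bar>fst v\<bar> + \<bar>snd v\<bar>)" for v
  proof -
    have "\<bar>c * f v - c * f' v\<bar> = \<bar>c\<bar> * \<bar>f v - f' v\<bar>"
      by (simp add: abs_mult flip: right_diff_distrib)
    also have "\<dots> \<le> (\<bar>c\<bar> + 1) * (\<epsilon> * (\<bar>fst v\<bar> + \<bar>snd v\<bar>))"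
      using 1(2) by (intro mult_mono) auto
    finally show ?thesis by (simp add: mult.assoc)
  qed
  moreover have "norm (c *\<^sub>R z - c *\<^sub>R z') \<le> (\<bar>c\<bar> + 1) * \<epsilon>"
  proof -
    have "norm (c *\<^sub>R z - c *\<^sub>R z') = \<bar>c\<bar> * norm (z - z')"
      by (simp flip: scaleR_diff_right)
    also have "\<dots> \<le> (\<bar>c\<bar> + 1) * \<epsilon>"
      using 1(3) by (intro mult_mono) auto
    finally show ?thesis .
  qed
  ultimately show "\<exists>h u. pwl x y h u \<and>
      (\<forall>v. \<bar>c * f v - h v\<bar> \<le> ((\<bar>c\<bar> + 1) * \<epsilon>) * (\<bar>fst v\<bar> + \<bar>snd v\<bar>)) \<and>
      norm (c *\<^sub>R z - u) \<le> (\<bar>c\<bar> + 1) * \<epsilon>"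
    using pwl_scale[OF 1(1), of c] by blast
qed simp

lemma pwl_abs_add: "pwl x y (\<lambda>v. \<bar>fst v\<bar> + \<bar>snd v\<bar>) (labs x + labs y)"
proof -
  have *: "(\<lambda>v::real \<times> real. \<bar>fst v\<bar> + \<bar>snd v\<bar>) =
      (\<lambda>v. max ((1, 0) \<bullet> v) ((- 1, 0) \<bullet> v) + max ((0, 1) \<bullet> v) ((0, - 1) \<bullet> v))"
    by (auto simp: inner_prod_def)
  have "pwl x y (\<lambda>v. max ((1, 0) \<bullet> v) ((- 1, 0) \<bullet> v) + max ((0, 1) \<bullet> v) ((0, - 1) \<bullet> v))
     (sup (lincomb x y (1, 0)) (lincomb x y (- 1, 0)) + sup (lincomb x y (0, 1)) (lincomb x y (0, - 1)))"
    by (intro pwl_add pwl_max pwl_lincomb)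
  then show ?thesis
    unfolding * by (simp add: lincomb_def labs_def)
qed

section \<open>Norm estimates, completeness, and existence and uniqueness of the calculus\<close>

context
  fixes E :: "'a::{banach, ordered_real_vector, lattice} itself"
  assumes bl: "banach_lattice E"
begin

lemma norm_le_labs: "labs a \<le> labs b \<Longrightarrow> norm a \<le> norm (b::'a)"
  using bl unfolding banach_lattice_def by blast

lemma norm_labs: "norm (labs a) = norm (a::'a)"
  by (intro antisym norm_le_labs) (simp_all add: labs_of_nonneg labs_nonneg)

lemma norm_le_of_between:
  assumes "- b \<le> a" "a \<le> (b::'a)"
  shows "norm a \<le> norm b"
proof (rule norm_le_labs)
  have "- a \<le> b"
    using assms(1) by (simp add: minus_le_iff)
  with assms(2) have "labs a \<le> b"
    by (simp add: labs_le_iff)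
  then show "labs a \<le> labs b"
    using le_labs(1) order_trans by blast
qed

lemma norm_sup_diff_le: "norm (sup a b - sup c d) \<le> norm (a - c) + norm (b - (d::'a))"
proof -
  have "norm (sup a b - sup c d) \<le> norm (labs (a - c) + labs (b - d))"
    using labs_sup_diff_le[of a b c d] order_trans[OF _ le_labs(1)] by (intro norm_le_labs) blast
  also have "\<dots> \<le> norm (a - c) + norm (b - d)"
    using norm_triangle_ineq[of "labs (a - c)" "labs (b - d)"] by (simp add: norm_labs)
  finally show ?thesis .
qed

lemma krivine_val_max:
  fixes x y :: 'a
  assumes "krivine_val x y f z" "krivine_val x y g w"
  shows "krivine_val x y (\<lambda>v. max (f v) (g v)) (sup z w)"
proof (rule krivine_valI[of 2])
  fix \<epsilon> :: real assume "0 < \<epsilon>"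
  obtain f' z' where 1: "pwl x y f' z'"
    "\<And>v. \<bar>f v - f' v\<bar> \<le> \<epsilon> * (\<bar>fst v\<bar> + \<bar>snd v\<bar>)" "norm (z - z') \<le> \<epsilon>"
    using krivine_valE[OF assms(1) \<open>0 < \<epsilon>\<close>] by blast
  obtain g' w' where 2: "pwl x y g' w'"
    "\<And>v. \<bar>g v - g' v\<bar> \<le> \<epsilon> * (\<bar>fst v\<bar> + \<bar>snd v\<bar>)" "norm (w - w') \<le> \<epsilon>"
    using krivine_valE[OF assms(2) \<open>0 < \<epsilon>\<close>] by blast
  have "\<bar>max (f v) (g v) - max (f' v) (g' v)\<bar> \<le> (2 * \<epsilon>) * (\<bar>fst v\<bar> + \<bar>snd v\<bar>)" for v
    using 1(2)[of v] 2(2)[of v] by linarith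
  moreover have "norm (sup z w - sup z' w') \<le> 2 * \<epsilon>"
    using norm_sup_diff_le[of z w z' w'] 1(3) 2(3) by linarith
  ultimately show "\<exists>h u. pwl x y h u \<and>
      (\<forall>v. \<bar>max (f v) (g v) - h v\<bar> \<le> (2 * \<epsilon>) * (\<bar>fst v\<bar> + \<bar>snd v\<bar>)) \<and> norm (sup z w - u) \<le> 2 * \<epsilon>"
    using pwl_max[OF 1(1) 2(1)] by blast
qed simp

text \<open>By \<open>pwl_mono\<close> the difference of the values lies between plus and minus
  \<open>d *\<^sub>R (labs x + labs y)\<close>, and a lattice norm respects this. The estimate
  drives both uniqueness and convergence below.\<close>

lemma pwl_norm_diff_le:
  fixes x y :: 'a
  assumes f: "pwl x y f z" and g: "pwl x y g w" and "0 \<le> d"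
    and le: "\<And>v. \<bar>f v - g v\<bar> \<le> d * (\<bar>fst v\<bar> + \<bar>snd v\<bar>)"
  shows "norm (z - w) \<le> d * norm (labs x + labs y)"
proof -
  have D: "pwl x y (\<lambda>v. f v + - g v) (z + - w)"
    using f g by (intro pwl_add pwl_uminus)
  have U: "pwl x y (\<lambda>v. d * (\<bar>fst v\<bar> + \<bar>snd v\<bar>)) (d *\<^sub>R (labs x + labs y))"
    by (intro pwl_scale pwl_abs_add)
  have "z + - w \<le> d *\<^sub>R (labs x + labs y)"
    using le by (intro pwl_mono[OF D U]) (simp add: abs_le_iff)
  moreover have "- (d *\<^sub>R (labs x + labs y)) \<le> z + - w"
  proof (rule pwl_mono[OF pwl_uminus[OF U] D])
    show "- (d * (\<bar>fst v\<bar> + \<bar>snd v\<bar>)) \<le> f v + - g v" for v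
      using le[of v] by linarith
  qed
  ultimately have "norm (z - w) \<le> norm (d *\<^sub>R (labs x + labs y))"
    by (intro norm_le_of_between) simp_all
  then show ?thesis
    using \<open>0 \<le> d\<close> by simp
qed

lemma krivine_val_unique:
  fixes x y :: 'a
  assumes "krivine_val x y f z" "krivine_val x y f w"
  shows "z = w"
proof -
  define M where "M = 2 + 2 * norm (labs x + labs y)"
  have "norm (z - w) \<le> M * \<epsilon>" if "0 < \<epsilon>" for \<epsilon>
  proof -
    obtain f' z' where 1: "pwl x y f' z'"
      "\<And>v. \<bar>f v - f' v\<bar> \<le> \<epsilon> * (\<bar>fst v\<bar> + \<bar>snd v\<bar>)" "norm (z - z') \<le> \<epsilon>"
      using krivine_valE[OF assms(1) \<open>0 < \<epsilon>\<close>] by blast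
    obtain g' w' where 2: "pwl x y g' w'"
      "\<And>v. \<bar>f v - g' v\<bar> \<le> \<epsilon> * (\<bar>fst v\<bar> + \<bar>snd v\<bar>)" "norm (w - w') \<le> \<epsilon>"
      using krivine_valE[OF assms(2) \<open>0 < \<epsilon>\<close>] by blast
    have "\<bar>f' v - g' v\<bar> \<le> (2 * \<epsilon>) * (\<bar>fst v\<bar> + \<bar>snd v\<bar>)" for v
      using 1(2)[of v] 2(2)[of v] by linarith
    then have "norm (z' - w') \<le> (2 * \<epsilon>) * norm (labs x + labs y)"
      using that by (intro pwl_norm_diff_le[OF 1(1) 2(1)]) auto
    moreover have "norm (z - w) \<le> norm (z - z') + norm (z' - w') + norm (w - w')"
      by norm
    ultimately show ?thesis
      using 1(3) 2(3) by (simp add: M_def algebra_simps)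
  qed
  moreover have "0 < M"
    unfolding M_def by (simp add: add_pos_nonneg)
  ultimately have "norm (z - w) \<le> \<epsilon>" if "0 < \<epsilon>" for \<epsilon>
    using that \<open>0 < M\<close> by (metis divide_pos_pos less_numeral_extra(3) nonzero_mult_div_cancel_left times_divide_eq_right)
  then have "norm (z - w) \<le> 0"
    using field_le_epsilon[of "norm (z - w)" 0] by simp
  then show ?thesis by simp
qed

text \<open>Piecewise linear approximations with error \<open>1 / (n + 1)\<close> have values
  forming a Cauchy sequence by \<open>pwl_norm_diff_le\<close>; completeness supplies the
  limit.\<close>

lemma krivine_val_exists:
  fixes x y :: 'a
  assumes "f \<in> H2"
  shows "\<exists>z. krivine_val x y f z"
proof -
  let ?M = "norm (labs x + labs y)"
  define r where "r n = inverse (real (Suc n))" for n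
  have r: "0 < r n" for n by (simp add: r_def)
  have rlim: "r \<longlonglongrightarrow> 0"
    unfolding r_def by (rule LIMSEQ_inverse_real_of_nat)
  have "\<exists>g w. pwl x y g w \<and> (\<forall>v. \<bar>f v - g v\<bar> \<le> r n * (\<bar>fst v\<bar> + \<bar>snd v\<bar>))" for n
    using pwl_dense[OF assms r] .
  then obtain g w where gw: "\<And>n. pwl x y (g n) (w n)"
    "\<And>n v. \<bar>f v - g n v\<bar> \<le> r n * (\<bar>fst v\<bar> + \<bar>snd v\<bar>)"
    by metis
  have diff: "norm (w m - w n) \<le> (r m + r n) * ?M" for m n
  proof (rule pwl_norm_diff_le[OF gw(1) gw(1)])
    show "\<bar>g m v - g n v\<bar> \<le> (r m + r n) * (\<bar>fst v\<bar> + \<bar>snd v\<bar>)" for v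
      using gw(2)[of v m] gw(2)[of v n] unfolding distrib_right[of "r m" "r n"] by linarith
  qed (use r in \<open>simp add: less_imp_le\<close>)
  have "Cauchy w"
  proof (rule CauchyI)
    fix e :: real assume "0 < e"
    have "(\<lambda>n. r n * ?M) \<longlonglongrightarrow> 0"
      using tendsto_mult_left_zero[OF rlim] .
    then have "\<forall>\<^sub>F n in sequentially. r n * ?M < e / 2"
      using \<open>0 < e\<close> by (intro order_tendstoD) auto
    then obtain N where N: "\<forall>n\<ge>N. r n * ?M < e / 2"
      by (auto simp: eventually_sequentially)
    have "norm (w m - w n) < e" if "m \<ge> N" "n \<ge> N" for m n
      using diff[of m n] N that unfolding distrib_right[of "r m" "r n"]
      by (smt (verit) field_sum_of_halves)
    then show "\<exists>N. \<forall>m\<ge>N. \<forall>n\<ge>N. norm (w m - w n) < e" by blast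
  qed
  then obtain z where z: "w \<longlonglongrightarrow> z"
    using Cauchy_convergent convergent_def by blast
  have "krivine_val x y f z"
    unfolding krivine_val_def
  proof safe
    fix \<epsilon> :: real assume "0 < \<epsilon>"
    then have "\<forall>\<^sub>F n in sequentially. r n < \<epsilon> \<and> dist (w n) z < \<epsilon>"
      using order_tendstoD(2)[OF rlim] tendstoD[OF z] by (simp add: eventually_conj)
    then obtain n where n: "r n < \<epsilon>" "dist (w n) z < \<epsilon>"
      by (auto simp: eventually_sequentially)
    have "\<bar>f v - g n v\<bar> \<le> \<epsilon> * (\<bar>fst v\<bar> + \<bar>snd v\<bar>)" for v
      using n(1) by (intro order_trans[OF gw(2)] mult_right_mono) auto
    moreover have "norm (z - w n) \<le> \<epsilon>"
      using n(2) by (simp add: dist_norm norm_minus_commute)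
    ultimately show "\<exists>g w. pwl x y g w \<and>
        (\<forall>v. \<bar>f v - g v\<bar> \<le> \<epsilon> * (\<bar>fst v\<bar> + \<bar>snd v\<bar>)) \<and> norm (z - w) \<le> \<epsilon>"
      using gw(1) by blast
  qed
  then show ?thesis ..
qed

text \<open>Positivity gives continuity for free: \<open>T f\<close> differs from the value of an
  approximant by at most \<open>\<epsilon> *\<^sub>R T u\<close> in the order, hence in norm. So
  every homomorphism computes the limit, with no continuity assumed.\<close>

lemma krivine_val_hom:
  fixes T :: "_ \<Rightarrow> 'a"
  assumes T: "krivine_hom T" and f: "f \<in> H2"
  shows "krivine_val (T fst) (T snd) f (T f)"
proof -
  define u where "u = (\<lambda>v::real \<times> real. \<bar>fst v\<bar> + \<bar>snd v\<bar>)"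
  have u: "u \<in> H2"
    unfolding u_def by (intro H2_intros)
  show ?thesis
  proof (rule krivine_valI[of "1 + norm (T u)"])
    fix \<epsilon> :: real assume "0 < \<epsilon>"
    obtain g w where g: "pwl (T fst) (T snd) g w" "\<And>v. \<bar>f v - g v\<bar> \<le> \<epsilon> * u v"
      using pwl_dense[OF f \<open>0 < \<epsilon>\<close>] unfolding u_def by blast
    have gH: "g \<in> H2"
      using g(1) by (rule pwl_in_H2)
    have "T (\<lambda>v. f v - g v) \<le> T (\<lambda>v. \<epsilon> * u v)"
      using g(2) by (intro krivine_hom_mono[OF T] H2_intros f gH u) (simp add: abs_le_iff)
    moreover have "T (\<lambda>v. - (\<epsilon> * u v)) \<le> T (\<lambda>v. f v - g v)"
    proof (intro krivine_hom_mono[OF T] H2_intros f gH u)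
      show "- (\<epsilon> * u v) \<le> f v - g v" for v
        using g(2)[of v] by linarith
    qed
    ultimately have "norm (T f - w) \<le> norm (\<epsilon> *\<^sub>R T u)"
      using f gH u by (intro norm_le_of_between)
        (simp_all add: krivine_hom_diff[OF T] krivine_hom_cmult[OF T] krivine_hom_uminus[OF T]
          krivine_hom_pwl[OF T g(1)] H2_cmult)
    also have "\<dots> \<le> (1 + norm (T u)) * \<epsilon>"
      using \<open>0 < \<epsilon>\<close> by (simp add: algebra_simps)
    finally have "norm (T f - w) \<le> (1 + norm (T u)) * \<epsilon>" .
    moreover have "\<bar>f v - g v\<bar> \<le> ((1 + norm (T u)) * \<epsilon>) * (\<bar>fst v\<bar> + \<bar>snd v\<bar>)" for v
    proof -
      have "\<epsilon> * u v \<le> ((1 + norm (T u)) * \<epsilon>) * u v"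
        using \<open>0 < \<epsilon>\<close> by (intro mult_right_mono) (auto simp: u_def algebra_simps)
      then show ?thesis
        using g(2)[of v] by (simp add: u_def)
    qed
    ultimately show "\<exists>g w. pwl (T fst) (T snd) g w \<and>
        (\<forall>v. \<bar>f v - g v\<bar> \<le> ((1 + norm (T u)) * \<epsilon>) * (\<bar>fst v\<bar> + \<bar>snd v\<bar>)) \<and>
        norm (T f - w) \<le> (1 + norm (T u)) * \<epsilon>"
      using g(1) by blast
  qed (simp add: add_pos_nonneg)
qed

lemma krivine_hom_exists: "\<exists>T. krivine_hom T \<and> T fst = x \<and> T snd = (y::'a)"
proof -
  define T where "T f = (THE z. krivine_val x y f z)" for f
  have T: "T f = z" if "krivine_val x y f z" for f z
    unfolding T_def using that krivine_val_unique by blast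
  have val: "krivine_val x y f (T f)" if "f \<in> H2" for f
    using krivine_val_exists[OF that] T by metis
  have "krivine_hom T"
    unfolding krivine_hom_def
    using val by (auto intro!: T krivine_val_add krivine_val_max krivine_val_cmult)
  moreover have "(\<lambda>v. (1, 0) \<bullet> v) = (fst :: real \<times> real \<Rightarrow> real)"
    "(\<lambda>v. (0, 1) \<bullet> v) = (snd :: real \<times> real \<Rightarrow> real)"
    by (auto simp: inner_prod_def)
  then have "T fst = x" "T snd = y"
    using T[OF krivine_val_pwl[OF pwl_lincomb[of x y "(1, 0)"]]]
      T[OF krivine_val_pwl[OF pwl_lincomb[of x y "(0, 1)"]]]
    by (simp_all add: lincomb_def)
  ultimately show ?thesis by blast
qed

text \<open>This justifies the definite description in \<open>krivine\<close>: any two homomorphisms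
  with the same coordinates give a \<open>krivine_val\<close> of \<open>f\<close>, and that value is
  unique.\<close>

lemma krivine_eq_hom:
  fixes T :: "_ \<Rightarrow> 'a"
  assumes "krivine_hom T" "f \<in> H2"
  shows "krivine (T fst) (T snd) f = T f"
  unfolding krivine_def
proof (rule the_equality)
  show "\<exists>S. krivine_hom S \<and> S fst = T fst \<and> S snd = T snd \<and> S f = T f"
    using assms by blast
next
  fix z assume "\<exists>S. krivine_hom S \<and> S fst = T fst \<and> S snd = T snd \<and> S f = z"
  then show "z = T f"
    using krivine_val_hom[OF _ assms(2)] krivine_val_unique assms(1) by metis
qed

section \<open>Rules of the calculus: homomorphism, composition, norm comparison\<close>

lemma krivine_hom_krivine: "krivine_hom (krivine x (y::'a))"
  and krivine_fst: "krivine x y fst = x" and krivine_snd: "krivine x y snd = y"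
proof -
  obtain T where T: "krivine_hom T" "T fst = x" "T snd = y"
    using krivine_hom_exists by blast
  then have *: "krivine x y f = T f" if "f \<in> H2" for f
    using krivine_eq_hom[OF T(1) that] by simp
  show "krivine x y fst = x" "krivine x y snd = y"
    using T by (simp_all add: * H2_intros)
  show "krivine_hom (krivine x y)"
    using T(1) unfolding krivine_hom_def by (simp add: * H2_intros)
qed

text \<open>Sending \<open>h\<close> to the value of \<open>h (f v, g v)\<close> is again a
  homomorphism, now with coordinates \<open>krivine x y f\<close> and \<open>krivine x y g\<close>;
  uniqueness identifies it.\<close>

lemma krivine_compose:
  assumes "f \<in> H2" "g \<in> H2" "h \<in> H2"
  shows "krivine (krivine x y f) (krivine x (y::'a) g) h = krivine x y (\<lambda>v. h (f v, g v))"
proof -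
  define T where "T h = krivine x y (\<lambda>v. h (f v, g v))" for h
  have "krivine_hom T"
    using krivine_hom_krivine[of x y] assms(1,2) H2_compose[OF assms(1,2)]
    unfolding krivine_hom_def T_def by simp
  from krivine_eq_hom[OF this assms(3)] show ?thesis
    by (simp add: T_def)
qed

text \<open>The bridge by which scalar inequalities on the plane become norm inequalities in the
  Banach lattice.\<close>

lemma norm_krivine_mono:
  assumes "f \<in> H2" "g \<in> H2" "\<And>v. \<bar>f v\<bar> \<le> \<bar>g v\<bar>"
  shows "norm (krivine x y f) \<le> norm (krivine x (y::'a) g)"
proof (rule norm_le_labs)
  have "krivine x y (\<lambda>v. \<bar>f v\<bar>) \<le> krivine x y (\<lambda>v. \<bar>g v\<bar>)"
    using assms by (intro krivine_hom_mono[OF krivine_hom_krivine] H2_abs)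
  then show "labs (krivine x y f) \<le> labs (krivine x y g)"
    using assms by (simp add: krivine_hom_abs[OF krivine_hom_krivine])
qed

lemma norm_krivine_abs: "f \<in> H2 \<Longrightarrow> norm (krivine x (y::'a) (\<lambda>v. \<bar>f v\<bar>)) = norm (krivine x y f)"
  by (intro antisym norm_krivine_mono H2_abs) auto

end

section \<open>Signed powers\<close>

lemma sgnpow_nonneg: "0 \<le> t \<Longrightarrow> sgnpow t s = t powr s"
  by (cases "t = 0") (auto simp: sgnpow_def)

lemma sgnpow_minus: "sgnpow (- t) s = - sgnpow t s"
  by (simp add: sgnpow_def sgn_minus)

lemma abs_sgnpow: "\<bar>sgnpow t s\<bar> = \<bar>t\<bar> powr s"
  by (cases "t = 0") (auto simp: sgnpow_def abs_mult abs_sgn_eq)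

lemma sgnpow_mult: "0 \<le> c \<Longrightarrow> sgnpow (c * t) s = c powr s * sgnpow t s"
  by (cases "c = 0") (auto simp: sgnpow_def sgn_mult abs_mult powr_mult)

lemma sgnpow_sgnpow: "sgnpow (sgnpow t r) s = sgnpow t (r * s)"
  by (cases "t = 0") (auto simp: sgnpow_def sgn_mult abs_mult powr_powr abs_sgn_eq sgn_if)

lemma sgnpow_one: "sgnpow t 1 = t"
  by (simp add: sgnpow_def sgn_mult_abs)

lemma sgnpow_inverse: "p \<noteq> 0 \<Longrightarrow> sgnpow (sgnpow t p) (1 / p) = t"
  "p \<noteq> 0 \<Longrightarrow> sgnpow (sgnpow t (1 / p)) p = t"
  by (simp_all add: sgnpow_sgnpow sgnpow_one)

lemma continuous_on_abs_powr:
  assumes "continuous_on A f" "0 < (s::real)"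
  shows "continuous_on A (\<lambda>x. \<bar>f x :: real\<bar> powr s)"
  using assms by (intro continuous_on_powr') (auto intro!: continuous_intros)

lemma continuous_on_sgnpow:
  assumes "continuous_on A f" "0 < s"
  shows "continuous_on A (\<lambda>x. sgnpow (f x) s)"
proof -
  \<comment> \<open>Splitting into positive and negative parts avoids \<open>sgn\<close>, which
    jumps at 0; the identity relies on \<open>0 powr s = 0\<close>.\<close>
  have *: "sgnpow t s = \<bar>max t 0\<bar> powr s - \<bar>max (- t) 0\<bar> powr s" for t
    by (cases "t \<ge> 0") (auto simp: sgnpow_def sgn_if)
  show ?thesis
    unfolding * using assms by (intro continuous_on_abs_powr continuous_intros)
qed

text \<open>The addition of the p-convexification of the real line: the signed p-th root carries it
  to ordinary addition.\<close>

definition pconv_fun :: "real \<Rightarrow> real \<times> real \<Rightarrow> real" where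
  "pconv_fun p = (\<lambda>(s, t). sgnpow (sgnpow s (1 / p) + sgnpow t (1 / p)) p)"

lemma pconv_add_eq: "pconv_add p x y = krivine x y (pconv_fun p)"
  by (simp add: pconv_add_def pconv_fun_def)

lemma sgnpow_pconv_fun:
  "p \<noteq> 0 \<Longrightarrow> sgnpow (pconv_fun p (s, t)) (1 / p) = sgnpow s (1 / p) + sgnpow t (1 / p)"
  by (simp add: pconv_fun_def sgnpow_inverse)

lemma H2_pconv_fun:
  assumes "0 < p"
  shows "pconv_fun p \<in> H2"
proof (rule H2I)
  show "continuous_on UNIV (pconv_fun p)"
    unfolding pconv_fun_def case_prod_beta
    using assms by (intro continuous_on_sgnpow continuous_intros) auto
  show "pconv_fun p (c *\<^sub>R v) = c * pconv_fun p v" if "0 \<le> c" for c v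
    using assms that
    by (simp add: pconv_fun_def case_prod_beta sgnpow_mult powr_powr flip: distrib_left)
qed

section \<open>Elementary inequalities for powers\<close>

text \<open>Write each \<open>c powr q\<close> as \<open>c * c powr (q - 1)\<close> and enlarge the
  second factor to \<open>(a + b) powr (q - 1)\<close>.\<close>

lemma powr_add_powr_le:
  fixes a b q :: real
  assumes "0 \<le> a" "0 \<le> b" "1 \<le> q"
  shows "(a powr q + b powr q) powr (1 / q) \<le> a + b"
proof -
  have split: "c powr q = c * c powr (q - 1)" if "0 \<le> c" for c :: real
    using that by (simp add: powr_mult_base)
  have "a powr q + b powr q \<le> a * (a + b) powr (q - 1) + b * (a + b) powr (q - 1)"
    using assms by (auto simp: split intro!: add_mono mult_left_mono powr_mono2)
  also have "\<dots> = (a + b) powr q"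
    using assms by (simp add: split algebra_simps)
  finally have "(a powr q + b powr q) powr (1 / q) \<le> ((a + b) powr q) powr (1 / q)"
    using assms by (intro powr_mono2) auto
  also have "\<dots> = a + b"
    using assms by (simp add: powr_powr)
  finally show ?thesis .
qed

text \<open>By the mean value theorem the slope between 1 and \<open>z\<close> is
  \<open>p * \<xi> powr (p - 1)\<close>, larger than \<open>p\<close> to the right of 1 and smaller
  to the left.\<close>

lemma powr_gt_tangent:
  fixes p z :: real
  assumes "1 < p" "0 < z" "z \<noteq> 1"
  shows "1 + p * (z - 1) < z powr p"
proof -
  have der: "((\<lambda>z. z powr p) has_real_derivative p * x powr (p - 1)) (at x)" if "0 < x" for x
    using that by (auto intro!: derivative_eq_intros)
  show ?thesis
  proof (cases "1 < z")
    case True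
    obtain \<xi> where "1 < \<xi>" "z powr p - 1 powr p = (z - 1) * (p * \<xi> powr (p - 1))"
      using MVT2[OF True, of "\<lambda>z. z powr p" "\<lambda>x. p * x powr (p - 1)"] der by auto
    moreover have "1 < \<xi> powr (p - 1)"
      using \<open>1 < \<xi>\<close> assms by (simp add: gr_one_powr)
    then have "(z - 1) * p < (z - 1) * (p * \<xi> powr (p - 1))"
      using True assms by simp
    ultimately show ?thesis by (simp add: mult.commute)
  next
    case False
    with assms have z: "z < 1" by simp
    obtain \<xi> where \<xi>: "z < \<xi>" "\<xi> < 1" "1 powr p - z powr p = (1 - z) * (p * \<xi> powr (p - 1))"
      using MVT2[OF z, of "\<lambda>z. z powr p" "\<lambda>x. p * x powr (p - 1)"] der assms(2) by auto
    have "\<xi> powr (p - 1) < 1 powr (p - 1)"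
      using \<xi> assms by (intro powr_less_mono2) auto
    then have "(1 - z) * (p * \<xi> powr (p - 1)) < (1 - z) * p"
      using z assms by simp
    with \<xi>(3) show ?thesis by (simp add: algebra_simps)
  qed
qed

lemma abs_powr_gt_tangent:
  fixes p u :: real
  assumes "1 < p" "u \<noteq> 0"
  shows "1 + p * u < \<bar>1 + u\<bar> powr p"
proof (cases "0 < 1 + u")
  case True
  then show ?thesis
    using powr_gt_tangent[of p "1 + u"] assms by simp
next
  case False
  then have "p * u \<le> p * (-1)"
    using assms by (intro mult_left_mono) auto
  then have "1 + p * u < 0"
    using assms by simp
  then show ?thesis
    using powr_ge_zero[of "\<bar>1 + u\<bar>" p] by linarith
qed

text \<open>Dividing by \<open>s\<close> reduces to the point 1, where the tangent inequalities for
  \<open>u\<close> and \<open>- u\<close> add up and the linear terms cancel.\<close>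

lemma abs_powr_strict_convex:
  fixes p s t :: real
  assumes "1 < p" "t \<noteq> 0"
  shows "\<bar>s\<bar> powr p < (\<bar>s + t\<bar> powr p + \<bar>s - t\<bar> powr p) / 2"
proof (cases "s = 0")
  case False
  define u where "u = t / s"
  have u: "u \<noteq> 0" "t = s * u"
    using False assms by (simp_all add: u_def)
  have "2 < \<bar>1 + u\<bar> powr p + \<bar>1 - u\<bar> powr p"
    using abs_powr_gt_tangent[of p u] abs_powr_gt_tangent[of p "- u"] assms(1) u(1) by simp
  then have "\<bar>s\<bar> powr p * 2 < \<bar>s\<bar> powr p * (\<bar>1 + u\<bar> powr p + \<bar>1 - u\<bar> powr p)"
    using False by (intro mult_strict_left_mono) auto
  also have "\<dots> = \<bar>s * (1 + u)\<bar> powr p + \<bar>s * (1 - u)\<bar> powr p"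
    by (simp add: abs_mult powr_mult distrib_left[of "_ powr _"])
  finally show ?thesis
    by (simp add: u(2) algebra_simps)
qed (use assms in simp)

lemma pconv_fun_strict_convex:
  assumes "1 < p" "t \<noteq> 0"
  shows "\<bar>s\<bar> < (\<bar>pconv_fun p (s, t)\<bar> + \<bar>pconv_fun p (s, - t)\<bar>) / 2"
proof -
  have "sgnpow t (1 / p) \<noteq> 0"
    using assms by (simp add: sgnpow_def sgn_0_0)
  then show ?thesis
    using abs_powr_strict_convex[of p "sgnpow t (1 / p)" "sgnpow s (1 / p)"] assms
    by (simp add: pconv_fun_def abs_sgnpow powr_powr sgnpow_minus)
qed

text \<open>Compactness makes strict convexity quantitative. The defect \<open>D\<close> is
  continuous, homogeneous and positive off the axis \<open>snd v = 0\<close>, so it has a positive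
  minimum on the arc of the unit circle inside the cone; this minimum serves as \<open>c\<close>.
  Outside the cone the extra term is 0.\<close>

lemma pconv_fun_convexity_bound:
  assumes p: "1 < p" and "0 < \<kappa>"
  shows "\<exists>c>0. \<forall>v. \<bar>fst v\<bar> + c * max 0 (\<bar>snd v\<bar> - \<kappa> * \<bar>fst v\<bar>)
    \<le> (\<bar>pconv_fun p v\<bar> + \<bar>pconv_fun p (fst v, - snd v)\<bar>) / 2"
proof -
  define D where "D v = 1 / 2 * (\<bar>pconv_fun p v\<bar> + \<bar>pconv_fun p (fst v, - snd v)\<bar>) - \<bar>fst v\<bar>" for v
  have D: "D \<in> H2"
    unfolding D_def using p
    by (intro H2_intros H2_pconv_fun H2_compose[where h = "pconv_fun p"]) auto
  have pos: "0 < D v" if "snd v \<noteq> 0" for v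
    using pconv_fun_strict_convex[OF p that, of "fst v"] by (simp add: D_def)
  have nonneg: "0 \<le> D v" for v
  proof (cases "snd v = 0")
    case True
    have "\<bar>pconv_fun p (s, 0)\<bar> = \<bar>s\<bar>" for s
      using p by (simp add: pconv_fun_def abs_sgnpow powr_powr sgnpow_nonneg[of 0])
    then show ?thesis
      using True by (cases v) (simp add: D_def)
  qed (use pos[of v] in simp)
  let ?K = "sphere 0 1 \<inter> {v::real \<times> real. \<kappa> * \<bar>fst v\<bar> \<le> \<bar>snd v\<bar>}"
  have "compact ?K"
    by (intro compact_Int_closed closed_Collect_le continuous_intros) auto
  moreover have "(0, 1) \<in> ?K"
    by simp
  then have "?K \<noteq> {}"
    by blast
  ultimately obtain w where w: "w \<in> ?K" "\<forall>v\<in>?K. D w \<le> D v"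
    using continuous_attains_inf[of ?K D] H2_continuous[OF D] continuous_on_subset by blast
  have "snd w \<noteq> 0"
  proof
    assume "snd w = 0"
    with w(1) \<open>0 < \<kappa>\<close> have "w = 0"
      by (auto simp: prod_eq_iff mult_le_0_iff)
    with w(1) show False by simp
  qed
  then have m: "0 < D w" by (rule pos)
  have key: "D w * max 0 (\<bar>snd v\<bar> - \<kappa> * \<bar>fst v\<bar>) \<le> D v" for v
  proof (cases "\<kappa> * \<bar>fst v\<bar> < \<bar>snd v\<bar>")
    case True
    define u where "u = (1 / norm v) *\<^sub>R v"
    have "v \<noteq> 0"
      using True by auto
    then have u: "norm v *\<^sub>R u = v" "norm u = 1"
      by (simp_all add: u_def)
    have "\<kappa> * \<bar>fst u\<bar> \<le> \<bar>snd u\<bar>"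
      using True \<open>v \<noteq> 0\<close> by (simp add: u_def divide_simps)
    then have "D w \<le> D u"
      using w(2) u(2) by simp
    then have "norm v * D w \<le> norm v * D u"
      by (intro mult_left_mono) auto
    also have "\<dots> = D v"
      using H2_scaleR[OF D norm_ge_zero, of v u] by (simp only: u(1))
    finally have *: "norm v * D w \<le> D v" .
    have "0 \<le> \<kappa> * \<bar>fst v\<bar>"
      using \<open>0 < \<kappa>\<close> by simp
    then have "\<bar>snd v\<bar> - \<kappa> * \<bar>fst v\<bar> \<le> norm v"
      using norm_snd_le[of "snd v" "fst v"] by simp
    then have "D w * (\<bar>snd v\<bar> - \<kappa> * \<bar>fst v\<bar>) \<le> D w * norm v"
      using m by simp
    with * True show ?thesis by (simp add: mult.commute)
  qed (use nonneg in auto)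
  show ?thesis
  proof (intro exI[of _ "D w"] conjI allI m)
    fix v
    show "\<bar>fst v\<bar> + D w * max 0 (\<bar>snd v\<bar> - \<kappa> * \<bar>fst v\<bar>)
        \<le> (\<bar>pconv_fun p v\<bar> + \<bar>pconv_fun p (fst v, - snd v)\<bar>) / 2"
      using key[of v] unfolding D_def[of v] by linarith
  qed
qed

section \<open>Uniform convexity and uniform monotonicity in terms of the original norm\<close>

lemma pconv_smult_minus_one: "pconv_smult p (- 1) y = - y"
  by (simp add: pconv_smult_def sgnpow_def)

text \<open>The norm of \<open>E^(p)\<close> is a p-th root of the original one, so passing between
  the two only rescales \<open>\<epsilon>\<close> and \<open>\<delta>\<close> by powers.\<close>

lemma pconv_uniformly_convex_iff:
  fixes E :: "'a::{real_normed_vector, lattice} itself"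
  assumes p: "1 < p"
  shows "pconv_uniformly_convex p E \<longleftrightarrow> (\<forall>\<epsilon>>0. \<exists>\<delta>>0. \<forall>x y::'a. norm x = 1 \<and> \<epsilon> \<le> norm y \<longrightarrow>
    1 + \<delta> \<le> max (norm (pconv_add p x y)) (norm (pconv_add p x (- y))))"
    (is "_ \<longleftrightarrow> ?R")
proof -
  have norm1: "pconv_norm p x = 1 \<longleftrightarrow> norm x = 1" for x :: 'a
  proof -
    have "pconv_norm p x powr p = norm x"
      using p by (simp add: pconv_norm_def powr_powr)
    then show ?thesis
      by (auto simp: pconv_norm_def)
  qed
  have norm_max: "max (a powr r) (b powr r) = max a b powr r" if "0 \<le> a" "0 \<le> b" "0 < r" for a b r :: real
    using that powr_less_mono2[of r b a] powr_mono2[of r a b] by (auto simp: max_def)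
  have max_eq: "max (pconv_norm p a) (pconv_norm p b) = max (norm a) (norm b) powr (1 / p)" for a b :: 'a
    using p by (simp add: pconv_norm_def norm_max)
  show ?thesis
  proof
    assume U: "pconv_uniformly_convex p E"
    show ?R
    proof (intro allI impI)
      fix \<epsilon> :: real assume "0 < \<epsilon>"
      then obtain \<delta> where \<delta>: "0 < \<delta>" "\<And>x y::'a. pconv_norm p x = 1 \<Longrightarrow> pconv_norm p y \<ge> \<epsilon> powr (1 / p) \<Longrightarrow>
          max (pconv_norm p (pconv_add p x y)) (pconv_norm p (pconv_add p x (- y))) \<ge> 1 + \<delta>"
        using U[unfolded pconv_uniformly_convex_def uniformly_convex_ops_def pconv_smult_minus_one]
        by (metis less_irrefl powr_gt_zero)
      have "1 + \<delta> \<le> max (norm (pconv_add p x y)) (norm (pconv_add p x (- y)))"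
        if "norm x = 1" "\<epsilon> \<le> norm y" for x y :: 'a
      proof -
        let ?m = "max (norm (pconv_add p x y)) (norm (pconv_add p x (- y)))"
        have "pconv_norm p y \<ge> \<epsilon> powr (1 / p)"
          unfolding pconv_norm_def using that \<open>0 < \<epsilon>\<close> p by (intro powr_mono2) auto
        then have *: "1 + \<delta> \<le> ?m powr (1 / p)"
          using \<delta>(2)[of x y] that by (simp add: norm1 max_eq)
        \<comment> \<open>Raising to the power \<open>p\<close> only enlarges numbers above 1, so
          the same \<open>\<delta>\<close> can be kept in this direction.\<close>
        have "1 + \<delta> \<le> (1 + \<delta>) powr p"
          using powr_mono[of 1 p "1 + \<delta>"] \<delta>(1) p by simp
        also have "\<dots> \<le> (?m powr (1 / p)) powr p"
          using * \<delta>(1) p by (intro powr_mono2) auto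
        also have "\<dots> = ?m"
          using p by (simp add: powr_powr le_max_iff_disj)
        finally show ?thesis .
      qed
      with \<delta>(1) show "\<exists>\<delta>>0. \<forall>x y::'a. norm x = 1 \<and> \<epsilon> \<le> norm y \<longrightarrow>
          1 + \<delta> \<le> max (norm (pconv_add p x y)) (norm (pconv_add p x (- y)))" by blast
    qed
  next
    assume R: ?R
    show "pconv_uniformly_convex p E"
      unfolding pconv_uniformly_convex_def uniformly_convex_ops_def pconv_smult_minus_one
    proof (intro allI impI)
      fix \<epsilon> :: real assume "0 < \<epsilon>"
      then obtain \<delta> where \<delta>: "0 < \<delta>" "\<And>x y::'a. norm x = 1 \<Longrightarrow> \<epsilon> powr p \<le> norm y \<Longrightarrow>
          1 + \<delta> \<le> max (norm (pconv_add p x y)) (norm (pconv_add p x (- y)))"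
        using R by (metis less_irrefl powr_gt_zero)
      have "1 + ((1 + \<delta>) powr (1 / p) - 1) \<le>
          max (pconv_norm p (pconv_add p x y)) (pconv_norm p (pconv_add p x (- y)))"
        if "pconv_norm p x = 1" "\<epsilon> \<le> pconv_norm p y" for x y :: 'a
      proof -
        have "\<epsilon> powr p \<le> (norm y powr (1 / p)) powr p"
          using that(2) \<open>0 < \<epsilon>\<close> p by (intro powr_mono2) (auto simp: pconv_norm_def)
        then have "\<epsilon> powr p \<le> norm y"
          using p by (simp add: powr_powr)
        then have "1 + \<delta> \<le> max (norm (pconv_add p x y)) (norm (pconv_add p x (- y)))"
          using \<delta>(2) that(1) by (simp add: norm1)
        then show ?thesis
          using \<delta>(1) p by (simp add: max_eq powr_mono2)
      qed
      moreover have "0 < (1 + \<delta>) powr (1 / p) - 1"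
        using \<delta>(1) p by (simp add: gr_one_powr)
      ultimately show "\<exists>\<delta>>0. \<forall>x y::'a. pconv_norm p x = 1 \<and> \<epsilon> \<le> pconv_norm p y \<longrightarrow>
          1 + \<delta> \<le> max (pconv_norm p (pconv_add p x y)) (pconv_norm p (pconv_add p x (- y)))" by blast
    qed
  qed
qed

context
  fixes E :: "'a::{banach, ordered_real_vector, lattice} itself"
  assumes bl: "banach_lattice E"
begin

text \<open>The case \<open>q = 1\<close> is the weakest: the \<open>q\<close>-sum lies below the
  ordinary sum of absolute values, so a gap for \<open>q\<close> is a gap for 1.\<close>

lemma uniformly_monotone_iff:
  "uniformly_monotone E \<longleftrightarrow> (\<forall>\<epsilon>>0. \<exists>\<delta>>0. \<forall>x y::'a. norm x = 1 \<and> \<epsilon> \<le> norm y \<longrightarrow>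
    1 + \<delta> \<le> norm (krivine x y (\<lambda>v. \<bar>fst v\<bar> + \<bar>snd v\<bar>)))"
    (is "_ \<longleftrightarrow> ?R")
proof
  assume "uniformly_monotone E"
  then obtain q where q: "1 \<le> q" and M: "\<And>\<epsilon>. 0 < \<epsilon> \<Longrightarrow> 0 < Mq E q \<epsilon>"
    unfolding uniformly_monotone_def by blast
  define f :: "real \<times> real \<Rightarrow> real" where "f = (\<lambda>(s, t). (\<bar>s\<bar> powr q + \<bar>t\<bar> powr q) powr (1 / q))"
  have f: "f \<in> H2"
  proof (rule H2I)
    have "f = (\<lambda>v. \<bar>\<bar>fst v\<bar> powr q + \<bar>snd v\<bar> powr q\<bar> powr (1 / q))"
      by (auto simp: f_def)
    moreover have "continuous_on UNIV (\<lambda>v::real \<times> real. \<bar>\<bar>fst v\<bar> powr q + \<bar>snd v\<bar> powr q\<bar> powr (1 / q))"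
      using q by (intro continuous_on_abs_powr continuous_on_add continuous_intros) auto
    ultimately show "continuous_on UNIV f" by simp
    show "f (c *\<^sub>R v) = c * f v" if "0 \<le> c" for c v
      using q that
      by (simp add: f_def case_prod_beta abs_mult powr_mult powr_powr flip: distrib_left)
  qed
  show ?R
  proof (intro allI impI)
    fix \<epsilon> :: real assume "0 < \<epsilon>"
    \<comment> \<open>\<open>Mq\<close> can be infinite, so a real number strictly below it is
      chosen.\<close>
    then obtain \<delta> where \<delta>: "0 < ereal \<delta>" "ereal \<delta> < Mq E q \<epsilon>"
      using ereal_dense2[OF M] by blast
    have "1 + \<delta> \<le> norm (krivine x y (\<lambda>v. \<bar>fst v\<bar> + \<bar>snd v\<bar>))"
      if "norm x = 1" "\<epsilon> \<le> norm y" for x y :: 'a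
    proof -
      have "Mq E q \<epsilon> \<le> ereal (norm (krivine x y f) - 1)"
        unfolding Mq_def f_def using that by (intro Inf_lower) auto
      with \<delta>(2) have "1 + \<delta> \<le> norm (krivine x y f)"
        using order_less_le_trans by fastforce
      also have "\<dots> \<le> norm (krivine x y (\<lambda>v. \<bar>fst v\<bar> + \<bar>snd v\<bar>))"
        using powr_add_powr_le q
        by (intro norm_krivine_mono[OF bl] f H2_intros) (auto simp: f_def case_prod_beta)
      finally show ?thesis .
    qed
    with \<delta>(1) show "\<exists>\<delta>>0. \<forall>x y::'a. norm x = 1 \<and> \<epsilon> \<le> norm y \<longrightarrow>
        1 + \<delta> \<le> norm (krivine x y (\<lambda>v. \<bar>fst v\<bar> + \<bar>snd v\<bar>))" by auto
  qed
next
  assume R: ?R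
  have eq: "(\<lambda>(s, t). (\<bar>s\<bar> powr 1 + \<bar>t\<bar> powr 1) powr (1 / 1)) =
      (\<lambda>v::real \<times> real. \<bar>fst v\<bar> + \<bar>snd v\<bar>)"
    by auto
  have "0 < Mq E 1 \<epsilon>" if "0 < \<epsilon>" for \<epsilon>
  proof -
    obtain \<delta> where \<delta>: "0 < \<delta>" "\<And>x y::'a. norm x = 1 \<Longrightarrow> \<epsilon> \<le> norm y \<Longrightarrow>
        1 + \<delta> \<le> norm (krivine x y (\<lambda>v. \<bar>fst v\<bar> + \<bar>snd v\<bar>))"
      using R[rule_format, OF \<open>0 < \<epsilon>\<close>] by blast
    have "ereal \<delta> \<le> Mq E 1 \<epsilon>"
      unfolding Mq_def eq using \<delta>(2) by (intro Inf_greatest) fastforce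
    then show ?thesis
      using \<delta>(1) by (meson ereal_less(2) less_le_trans)
  qed
  then show "uniformly_monotone E"
    unfolding uniformly_monotone_def by auto
qed

end

section \<open>The equivalence\<close>

text \<open>Either \<open>t\<close> is a small fraction of the total, and the first term on the
  right suffices, or \<open>s\<close> is so far below the total that the difference of the p-th
  roots is at least the fraction \<open>\<theta>\<close> of the larger root.\<close>

lemma midpoint_deviation_bound:
  assumes p: "1 < p" and \<eta>: "0 < \<eta>" "\<eta> < 1"
  shows "\<exists>c>0. \<forall>s t. c * \<bar>t\<bar> \<le> c * \<eta> * (\<bar>s\<bar> + \<bar>t\<bar>) + pconv_fun p (\<bar>s\<bar> + \<bar>t\<bar>, - \<bar>s\<bar>)"
proof -
  \<comment> \<open>Chosen so that \<open>(1 - \<theta>) powr p = 1 - \<eta>\<close>.\<close>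
  define \<theta> where "\<theta> = 1 - (1 - \<eta>) powr (1 / p)"
  have "(1 - \<eta>) powr (1 / p) < 1 powr (1 / p)"
    using p \<eta> by (intro powr_less_mono2) auto
  then have \<theta>: "0 < \<theta>" by (simp add: \<theta>_def)
  have "\<theta> powr p * \<bar>t\<bar> \<le> \<theta> powr p * \<eta> * (\<bar>s\<bar> + \<bar>t\<bar>) + pconv_fun p (\<bar>s\<bar> + \<bar>t\<bar>, - \<bar>s\<bar>)" for s t
  proof -
    define R S where "R = (\<bar>s\<bar> + \<bar>t\<bar>) powr (1 / p)" and "S = \<bar>s\<bar> powr (1 / p)"
    have "S \<le> R"
      unfolding R_def S_def using p by (intro powr_mono2) auto
    then have F: "pconv_fun p (\<bar>s\<bar> + \<bar>t\<bar>, - \<bar>s\<bar>) = (R - S) powr p"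
      by (simp add: pconv_fun_def sgnpow_minus sgnpow_nonneg R_def S_def)
    show ?thesis
    proof (cases "\<bar>t\<bar> \<le> \<eta> * (\<bar>s\<bar> + \<bar>t\<bar>)")
      case True
      then have "\<theta> powr p * \<bar>t\<bar> \<le> \<theta> powr p * (\<eta> * (\<bar>s\<bar> + \<bar>t\<bar>))"
        by (intro mult_left_mono) auto
      also have "\<dots> \<le> \<theta> powr p * \<eta> * (\<bar>s\<bar> + \<bar>t\<bar>) + (R - S) powr p"
        by (simp add: mult.assoc)
      finally show ?thesis
        by (simp add: F)
    next
      case False
      then have "\<bar>s\<bar> \<le> (1 - \<eta>) * (\<bar>s\<bar> + \<bar>t\<bar>)"
        by (simp add: algebra_simps)
      then have "S \<le> ((1 - \<eta>) * (\<bar>s\<bar> + \<bar>t\<bar>)) powr (1 / p)"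
        unfolding S_def using p by (intro powr_mono2) auto
      also have "\<dots> = (1 - \<theta>) * R"
        using \<eta> by (simp add: powr_mult R_def \<theta>_def)
      finally have "\<theta> * R \<le> R - S"
        by (simp add: algebra_simps)
      then have "(\<theta> * R) powr p \<le> (R - S) powr p"
        using p \<theta> by (intro powr_mono2) (auto simp: R_def)
      then have "\<theta> powr p * (\<bar>s\<bar> + \<bar>t\<bar>) \<le> (R - S) powr p"
        using p \<theta> by (simp add: powr_mult R_def powr_powr)
      moreover have "\<theta> powr p * \<bar>t\<bar> \<le> \<theta> powr p * (\<bar>s\<bar> + \<bar>t\<bar>)"
        by (intro mult_left_mono) auto
      moreover have "0 \<le> \<theta> powr p * \<eta> * (\<bar>s\<bar> + \<bar>t\<bar>)"
        using \<eta> by simp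
      ultimately show ?thesis
        by (simp add: F)
    qed
  qed
  then show ?thesis
    using \<theta> by (intro exI[of _ "\<theta> powr p"]) simp
qed

context
  fixes E :: "'a::{banach, ordered_real_vector, lattice} itself"
  assumes bl: "banach_lattice E"
begin

lemma norm_krivine_le_add:
  assumes "f \<in> H2" "g \<in> H2" "h \<in> H2" "\<And>v. \<bar>f v\<bar> \<le> g v + h v"
  shows "norm (krivine x y f) \<le> norm (krivine x y g) + norm (krivine x (y::'a) h)"
proof -
  have "norm (krivine x y f) \<le> norm (krivine x y (\<lambda>v. g v + h v))"
    using assms(1-3) by (intro norm_krivine_mono[OF bl] H2_add) (simp_all add: order_trans[OF assms(4) abs_ge_self])
  also have "\<dots> \<le> norm (krivine x y g) + norm (krivine x y h)"
    using assms by (simp add: krivine_hom_add[OF krivine_hom_krivine[OF bl]] norm_triangle_ineq)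
  finally show ?thesis .
qed

lemma norm_krivine_cmult:
  "f \<in> H2 \<Longrightarrow> norm (krivine x y (\<lambda>v. c * f v)) = \<bar>c\<bar> * norm (krivine x (y::'a) f)"
  by (simp add: krivine_hom_cmult[OF krivine_hom_krivine[OF bl]])

lemma pconv_add_krivine:
  assumes "0 < p" "f \<in> H2" "g \<in> H2"
  shows "pconv_add p (krivine x y f) (krivine x (y::'a) g) = krivine x y (\<lambda>v. pconv_fun p (f v, g v))"
  using assms by (simp add: pconv_add_eq krivine_compose[OF bl] H2_pconv_fun)

text \<open>The average of the absolute values of the sum and the difference in \<open>E^(p)\<close>
  dominates \<open>labs x\<close> plus a multiple of the part of \<open>labs y\<close> exceeding
  \<open>\<kappa> *\<^sub>R labs x\<close>. Uniform monotonicity applies to these two terms, and a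
  maximum is at least the average.\<close>

lemma uniformly_monotone_imp_uniformly_convex:
  assumes UM: "uniformly_monotone E" and p: "1 < p"
  shows "pconv_uniformly_convex p E"
  unfolding pconv_uniformly_convex_iff[OF p]
proof (intro allI impI)
  fix \<epsilon> :: real assume \<epsilon>: "0 < \<epsilon>"
  \<comment> \<open>As \<open>norm x = 1\<close>, cutting off
    \<open>\<kappa> *\<^sub>R labs x\<close> costs at most half of \<open>\<epsilon>\<close>,
    leaving norm at least \<open>\<epsilon> / 2\<close>.\<close>
  define \<kappa> where "\<kappa> = \<epsilon> / 2"
  obtain c where c: "0 < c" and bound: "\<And>v. \<bar>fst v\<bar> + c * max 0 (\<bar>snd v\<bar> - \<kappa> * \<bar>fst v\<bar>)
      \<le> (\<bar>pconv_fun p v\<bar> + \<bar>pconv_fun p (fst v, - snd v)\<bar>) / 2"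
    using pconv_fun_convexity_bound[OF p, of \<kappa>] \<epsilon> by (auto simp: \<kappa>_def)
  obtain \<delta> where \<delta>: "0 < \<delta>" "\<And>x y::'a. norm x = 1 \<Longrightarrow> c * \<epsilon> / 2 \<le> norm y \<Longrightarrow>
      1 + \<delta> \<le> norm (krivine x y (\<lambda>v. \<bar>fst v\<bar> + \<bar>snd v\<bar>))"
    using UM[unfolded uniformly_monotone_iff[OF bl], rule_format, of "c * \<epsilon> / 2"] c \<epsilon> by auto
  have "1 + \<delta> \<le> max (norm (pconv_add p x y)) (norm (pconv_add p x (- y)))"
    if x: "norm x = 1" and y: "\<epsilon> \<le> norm y" for x y :: 'a
  proof -
    let ?w = "\<lambda>v::real \<times> real. max 0 (\<bar>snd v\<bar> - \<kappa> * \<bar>fst v\<bar>)"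
    let ?N = "\<lambda>v::real \<times> real. \<bar>fst v\<bar> + \<bar>snd v\<bar>"
    let ?F = "pconv_fun p" and ?G = "\<lambda>v. pconv_fun p (fst v, - snd v)"
    have "(\<lambda>v. max (0 * fst v) (\<bar>snd v\<bar> - \<kappa> * \<bar>fst v\<bar>)) \<in> H2"
      by (intro H2_intros)
    then have w: "?w \<in> H2" by simp
    have F: "?F \<in> H2" and G: "?G \<in> H2"
      using p by (auto intro!: H2_intros H2_pconv_fun H2_compose)
    have "norm (krivine x y snd) \<le> norm (krivine x y ?w) + norm (krivine x y (\<lambda>v. \<kappa> * \<bar>fst v\<bar>))"
      by (intro norm_krivine_le_add w H2_cmult H2_abs H2_fst H2_snd) auto
    moreover have "norm (krivine x y (\<lambda>v. \<kappa> * \<bar>fst v\<bar>)) = \<kappa>"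
      using x \<epsilon> by (subst norm_krivine_cmult)
        (simp_all add: norm_krivine_abs[OF bl] H2_intros krivine_fst[OF bl] \<kappa>_def)
    ultimately have "\<epsilon> \<le> norm (krivine x y ?w) + \<kappa>"
      using y by (simp add: krivine_snd[OF bl])
    then have "c * (\<epsilon> / 2) \<le> c * norm (krivine x y ?w)"
      using c by (intro mult_left_mono) (auto simp: \<kappa>_def)
    then have "c * \<epsilon> / 2 \<le> norm (krivine x y (\<lambda>v. c * ?w v))"
      using c w by (simp add: norm_krivine_cmult)
    then have "1 + \<delta> \<le> norm (krivine x (krivine x y (\<lambda>v. c * ?w v)) ?N)"
      by (intro \<delta>(2) x)
    also have "krivine x (krivine x y (\<lambda>v. c * ?w v)) ?N = krivine x y (\<lambda>v. \<bar>fst v\<bar> + \<bar>c * ?w v\<bar>)"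
      using krivine_compose[OF bl H2_fst H2_cmult[OF w, of c], of ?N x y]
      by (simp add: krivine_fst[OF bl] H2_intros)
    also have "norm \<dots> \<le> norm (krivine x y (\<lambda>v. 1 / 2 * \<bar>?F v\<bar>)) + norm (krivine x y (\<lambda>v. 1 / 2 * \<bar>?G v\<bar>))"
    proof (intro norm_krivine_le_add H2_add H2_abs H2_cmult H2_fst w F G)
      fix v
      show "\<bar>\<bar>fst v\<bar> + \<bar>c * ?w v\<bar>\<bar> \<le> 1 / 2 * \<bar>?F v\<bar> + 1 / 2 * \<bar>?G v\<bar>"
        using bound[of v] c by (simp add: abs_mult)
    qed
    also have "\<dots> = (norm (krivine x y ?F) + norm (krivine x y ?G)) / 2"
      by (simp only: norm_krivine_cmult[OF H2_abs[OF F]] norm_krivine_cmult[OF H2_abs[OF G]]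
          norm_krivine_abs[OF bl F] norm_krivine_abs[OF bl G]) simp
    also have "krivine x y ?F = pconv_add p x y"
      by (simp add: pconv_add_eq)
    also have "krivine x y ?G = pconv_add p x (- y)"
      using pconv_add_krivine[of p fst "\<lambda>v. - snd v" x y] p
      by (simp add: H2_intros krivine_hom_uminus[OF krivine_hom_krivine[OF bl]]
          krivine_fst[OF bl] krivine_snd[OF bl])
    also have "(norm (pconv_add p x y) + norm (pconv_add p x (- y))) / 2
        \<le> max (norm (pconv_add p x y)) (norm (pconv_add p x (- y)))"
      by (simp add: max_def)
    finally show ?thesis .
  qed
  with \<delta>(1) show "\<exists>\<delta>>0. \<forall>x y::'a. norm x = 1 \<and> \<epsilon> \<le> norm y \<longrightarrow>
      1 + \<delta> \<le> max (norm (pconv_add p x y)) (norm (pconv_add p x (- y)))" by blast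
qed

text \<open>If the conclusion failed, the elements given by \<open>a\<close> and \<open>b\<close>,
  divided by the norm \<open>A\<close> of the former, would violate uniform convexity: their sum and
  difference in \<open>E^(p)\<close> are multiples of \<open>labs x + labs y\<close> and
  \<open>labs x\<close>, both of norm below \<open>1 + \<delta>\<close>, while the second element
  stays large.\<close>

lemma uniformly_convex_imp_uniformly_monotone:
  assumes UC: "pconv_uniformly_convex p E" and p: "1 < p"
  shows "uniformly_monotone E"
  unfolding uniformly_monotone_iff[OF bl]
proof (intro allI impI)
  fix \<epsilon> :: real assume \<epsilon>: "0 < \<epsilon>"
  \<comment> \<open>The bound \<open>\<epsilon> / 4\<close> makes the error term at most
    \<open>c * \<epsilon> / 2\<close> once the norm of the sum is below 2; the bound
    \<open>1 / 2\<close> keeps \<open>\<eta>\<close> below 1.\<close>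
  define \<eta> where "\<eta> = min (1 / 2) (\<epsilon> / 4)"
  have \<eta>: "0 < \<eta>" "\<eta> < 1" "\<eta> \<le> \<epsilon> / 4"
    using \<epsilon> by (auto simp: \<eta>_def)
  obtain c where c: "0 < c" and
    bound: "\<And>s t. c * \<bar>t\<bar> \<le> c * \<eta> * (\<bar>s\<bar> + \<bar>t\<bar>) + pconv_fun p (\<bar>s\<bar> + \<bar>t\<bar>, - \<bar>s\<bar>)"
    using midpoint_deviation_bound[OF p \<eta>(1,2)] by blast
  \<comment> \<open>Multiplication by \<open>h\<close> in \<open>E\<close> is scalar multiplication
    by one half in \<open>E^(p)\<close>.\<close>
  define h where "h = (1 / 2 :: real) powr p"
  have h: "0 < h" by (simp add: h_def)
  have h_root: "h powr (1 / p) = 1 / 2"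
    using p by (simp add: h_def powr_powr)
  \<comment> \<open>Half of the lower bound \<open>h * c * \<epsilon> / 2\<close> that
    \<open>b\<close> will satisfy, since normalising divides by \<open>A\<close>, which is at most
    2.\<close>
  define \<epsilon>' where "\<epsilon>' = h * c * \<epsilon> / 4"
  have "0 < \<epsilon>'"
    using h c \<epsilon> by (simp add: \<epsilon>'_def)
  then obtain \<delta> where \<delta>: "0 < \<delta>" "\<And>x y::'a. norm x = 1 \<Longrightarrow> \<epsilon>' \<le> norm y \<Longrightarrow>
      1 + \<delta> \<le> max (norm (pconv_add p x y)) (norm (pconv_add p x (- y)))"
    using UC[unfolded pconv_uniformly_convex_iff[OF p]] by metis
  \<comment> \<open>Capping at 1 ensures that the negated inequality also bounds the norm of the sum
    by 2.\<close>
  have "1 + min \<delta> 1 \<le> norm (krivine x y (\<lambda>v. \<bar>fst v\<bar> + \<bar>snd v\<bar>))"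
    if x: "norm x = 1" and y: "\<epsilon> \<le> norm y" for x y :: 'a
  proof (rule ccontr)
    let ?S = "\<lambda>v::real \<times> real. \<bar>fst v\<bar>" and ?N = "\<lambda>v::real \<times> real. \<bar>fst v\<bar> + \<bar>snd v\<bar>"
    assume "\<not> 1 + min \<delta> 1 \<le> norm (krivine x y ?N)"
    then have N: "norm (krivine x y ?N) < 1 + \<delta>" "norm (krivine x y ?N) < 2"
      by auto
    have S1: "norm (krivine x y ?S) = 1"
      using x by (simp add: norm_krivine_abs[OF bl] H2_intros krivine_fst[OF bl])
    \<comment> \<open>In \<open>E\<^sup>(\<^sup>p\<^sup>)\<close>, \<open>a\<close> is the midpoint of \<open>|x|\<close> and \<open>|x| + |y|\<close>, and \<open>b\<close> half their difference.\<close>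
    define a where "a v = h * pconv_fun p (?N v, ?S v)" for v
    define b where "b v = h * pconv_fun p (?N v, - ?S v)" for v
    have H: "?S \<in> H2" "?N \<in> H2"
      by (intro H2_intros)+
    have b0: "(\<lambda>v. pconv_fun p (?N v, - ?S v)) \<in> H2"
      using p by (intro H2_compose H2_intros H2_pconv_fun) auto
    have ab: "a \<in> H2" "b \<in> H2"
      unfolding a_def b_def using p by (intro H2_intros H2_compose[where h = "pconv_fun p"] H2_pconv_fun; simp)+
    have root_a: "sgnpow (a v) (1 / p) = (sgnpow (?N v) (1 / p) + sgnpow (?S v) (1 / p)) / 2"
      and root_b: "sgnpow (b v) (1 / p) = (sgnpow (?N v) (1 / p) - sgnpow (?S v) (1 / p)) / 2" for v
      unfolding a_def b_def using h p
      by (simp_all add: sgnpow_mult h_root sgnpow_pconv_fun sgnpow_minus)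
    \<comment> \<open>Half-sum plus or minus half-difference of the p-th roots returns the two
      original roots.\<close>
    have plus: "pconv_fun p (a v, b v) = ?N v" and minus: "pconv_fun p (a v, - b v) = ?S v" for v
      using p unfolding pconv_fun_def prod.case sgnpow_minus root_a root_b
      by (simp_all add: sgnpow_inverse flip: add_divide_distrib diff_divide_distrib)
    \<comment> \<open>A midpoint of two ordered numbers lies between them, also after taking p-th
      roots; this puts \<open>A\<close> between 1 and 2.\<close>
    have a_bounds: "?S v \<le> a v \<and> a v \<le> ?N v" for v
    proof -
      have "?S v powr (1 / p) \<le> ?N v powr (1 / p)"
        using p by (intro powr_mono2) auto
      then have r: "?S v powr (1 / p) \<le> sgnpow (a v) (1 / p)" "sgnpow (a v) (1 / p) \<le> ?N v powr (1 / p)"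
        by (simp_all add: root_a sgnpow_nonneg)
      have "0 \<le> sgnpow (a v) (1 / p)"
        using r(1) powr_ge_zero order_trans by blast
      then have "a v = sgnpow (a v) (1 / p) powr p"
        using sgnpow_inverse(2)[of p "a v"] p by (simp add: sgnpow_nonneg)
      moreover have "(?S v powr (1 / p)) powr p \<le> sgnpow (a v) (1 / p) powr p"
        using r p by (intro powr_mono2) auto
      moreover have "sgnpow (a v) (1 / p) powr p \<le> (?N v powr (1 / p)) powr p"
        using r \<open>0 \<le> sgnpow (a v) (1 / p)\<close> p by (intro powr_mono2) auto
      ultimately show ?thesis
        using p by (simp add: powr_powr)
    qed
    define A where "A = norm (krivine x y a)"
    have "norm (krivine x y ?S) \<le> A"
      unfolding A_def using a_bounds ab H by (intro norm_krivine_mono[OF bl]) (auto intro: order_trans[OF _ abs_ge_self])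
    then have "1 \<le> A" by (simp add: S1)
    have "A \<le> norm (krivine x y ?N)"
      unfolding A_def
    proof (intro norm_krivine_mono[OF bl] ab H)
      show "\<bar>a v\<bar> \<le> \<bar>?N v\<bar>" for v
        using a_bounds[of v] by linarith
    qed
    with N have "A \<le> 2" by simp
    have "norm (krivine x y (\<lambda>v. c * snd v)) \<le> norm (krivine x y (\<lambda>v. (c * \<eta>) * ?N v))
        + norm (krivine x y (\<lambda>v. pconv_fun p (?N v, - ?S v)))"
      using bound c by (intro norm_krivine_le_add H2_cmult H2_snd H b0) (auto simp: abs_mult)
    then have "c * norm y \<le> c * \<eta> * norm (krivine x y ?N)
        + norm (krivine x y (\<lambda>v. pconv_fun p (?N v, - ?S v)))"
      using c \<eta> H by (simp add: norm_krivine_cmult H2_snd krivine_snd[OF bl])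
    also have "norm (krivine x y (\<lambda>v. pconv_fun p (?N v, - ?S v))) = norm (krivine x y b) / h"
      unfolding b_def using h b0 by (simp add: norm_krivine_cmult)
    also have "c * \<eta> * norm (krivine x y ?N) \<le> c * (\<epsilon> / 4) * 2"
      using c \<eta> \<epsilon> N by (intro mult_mono) auto
    finally have "c * norm y \<le> c * \<epsilon> / 2 + norm (krivine x y b) / h"
      by (simp add: mult.commute)
    moreover have "c * \<epsilon> \<le> c * norm y"
      using c y by simp
    ultimately have "c * \<epsilon> / 2 \<le> norm (krivine x y b) / h" by linarith
    then have "h * c * \<epsilon> / 2 \<le> norm (krivine x y b)"
      using h by (simp add: field_simps)
    moreover have "\<epsilon>' * A \<le> \<epsilon>' * 2"
      using \<open>A \<le> 2\<close> \<open>0 < \<epsilon>'\<close> by simp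
    moreover have "\<epsilon>' * 2 = h * c * \<epsilon> / 2"
      by (simp add: \<epsilon>'_def)
    ultimately have "\<epsilon>' * A \<le> norm (krivine x y b)"
      by linarith
    then have "\<epsilon>' \<le> \<bar>1 / A\<bar> * norm (krivine x y b)"
      using \<open>1 \<le> A\<close> by (simp add: le_divide_eq)
    then have b': "\<epsilon>' \<le> norm (krivine x y (\<lambda>v. 1 / A * b v))"
      by (simp only: norm_krivine_cmult[OF ab(2)])
    have a': "norm (krivine x y (\<lambda>v. 1 / A * a v)) = 1"
      using \<open>1 \<le> A\<close> by (simp only: norm_krivine_cmult[OF ab(1)] A_def[symmetric]) simp
    \<comment> \<open>Homogeneity lets the factor \<open>1 / A\<close> pass through the addition of
      \<open>E^(p)\<close>, so normalising the midpoint preserves the relations \<open>plus\<close>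
      and \<open>minus\<close>.\<close>
    have scaled: "pconv_fun p (1 / A * s, 1 / A * t) = 1 / A * pconv_fun p (s, t)" for s t
      using H2_scaleR[OF H2_pconv_fun, of p "1 / A" "(s, t)"] p \<open>1 \<le> A\<close> by simp
    have neg: "- krivine x y (\<lambda>v. 1 / A * b v) = krivine x y (\<lambda>v. 1 / A * - b v)"
      using krivine_hom_uminus[OF krivine_hom_krivine[OF bl] H2_cmult[OF ab(2)], of x y "1 / A"] by simp
    have "norm (pconv_add p (krivine x y (\<lambda>v. 1 / A * a v)) (krivine x y (\<lambda>v. 1 / A * b v)))
        = 1 / A * norm (krivine x y ?N)"
      using p ab H \<open>1 \<le> A\<close> by (simp only: pconv_add_krivine H2_cmult scaled plus norm_krivine_cmult) simp
    moreover have "norm (pconv_add p (krivine x y (\<lambda>v. 1 / A * a v)) (- krivine x y (\<lambda>v. 1 / A * b v)))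
        = 1 / A * norm (krivine x y ?S)"
      unfolding neg
      using p ab H \<open>1 \<le> A\<close> by (simp only: pconv_add_krivine H2_cmult H2_uminus scaled minus norm_krivine_cmult) simp
    ultimately have "1 + \<delta> \<le> max (1 / A * norm (krivine x y ?N)) (1 / A * norm (krivine x y ?S))"
      using \<delta>(2)[OF a' b'] by simp
    moreover have "1 / A * norm z \<le> norm z" for z :: 'a
      using \<open>1 \<le> A\<close> by (intro mult_left_le_one_le) auto
    from this[of "krivine x y ?N"] this[of "krivine x y ?S"]
    have "1 / A * norm (krivine x y ?N) < 1 + \<delta>" "1 / A * norm (krivine x y ?S) < 1 + \<delta>"
      using N(1) S1 \<delta>(1) by linarith+
    ultimately show False
      by linarith
  qed
  then show "\<exists>\<delta>>0. \<forall>x y::'a. norm x = 1 \<and> \<epsilon> \<le> norm y \<longrightarrow>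
      1 + \<delta> \<le> norm (krivine x y (\<lambda>v. \<bar>fst v\<bar> + \<bar>snd v\<bar>))"
    using \<delta>(1) by (intro exI[of _ "min \<delta> 1"]) auto
qed

end

theorem theorem3p2:
  fixes E :: "'a::{banach, ordered_real_vector, lattice} itself"
  assumes "banach_lattice E"
  shows "(uniformly_monotone E \<longleftrightarrow> (\<forall>p>1. pconv_uniformly_convex p E))
       \<and> ((\<forall>p>1. pconv_uniformly_convex p E) \<longleftrightarrow> (\<exists>p>1. pconv_uniformly_convex p E))"
proof -
  have "(2::real) > 1" by simp
  then show ?thesis
    using uniformly_monotone_imp_uniformly_convex[OF assms]
      uniformly_convex_imp_uniformly_monotone[OF assms] by blast
qed

end
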